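(* Let $R$ be a commutative ring with $\mathbb{Q}\subseteq R$, $\nu\in\mathbb{N}_0^k$, $p \in R[y_1, \dots, y_d]$, $x \in R^d$, and $v_1, \dots, v_k \in R^d$. In $B_k^\nu$: $$p\big(x + \textstyle\sum_i \delta_i v_i\big) = \sum_{0 \leq \alpha \leq \nu} \frac{1}{\alpha!}\, \Delta^\alpha(p; x; v_\bullet)\, (\delta)_\alpha, \qquad \Delta^\alpha(p; x; v_\bullet) = \sum_{\beta \leq \alpha} (-1)^{\mathrm{wt}(\alpha-\beta)}\, \frac{(\alpha)_\beta}{\beta!}\, p\big(x + \textstyle\sum_i \beta_i v_i\big).$$ In $A_k^\nu$: $$p\big(x + \textstyle\sum_i \varepsilon_i v_i\big) = \sum_{0 \leq \alpha \leq \nu} \frac{1}{\alpha!}\, D^\alpha(p; x; v_\bullet)\, \varepsilon^\alpha, \qquad \varepsilon^\nu\, D^\nu(p; x; v_\bullet) = \sum_{\beta \leq \nu} (-1)^{\mathrm{wt}(\nu-\beta)}\, \frac{(\nu)_\beta}{\beta!}\, p\big(x + \textstyle\sum_i \beta_i \varepsilon_i v_i\big).$$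
   Context: For $\alpha,\beta\in\mathbb{N}_0^k$: $\le$ is componentwise, $\mathrm{wt}(\alpha)=\sum_i\alpha_i$, $\alpha!=\prod_i\alpha_i!$, $(\alpha)_\beta=\prod_i(\alpha_i)_{\beta_i}$ with falling factorial $(n)_r=n(n-1)\cdots(n-r+1)$. Grid algebra: $B_k^\nu=R[\delta_1,\dots,\delta_k]/\big((\delta_i)_{\nu_i+1}:1\le i\le k\big)$ with $(\delta_i)_{j}=\delta_i(\delta_i-1)\cdots(\delta_i-j+1)$; $(\delta)_\alpha=\prod_i(\delta_i)_{\alpha_i}$. Taylor algebra: $A_k^\nu=R[\varepsilon_1,\dots,\varepsilon_k]/(\varepsilon_i^{\nu_i+1}:1\le i\le k)$; $\varepsilon^\alpha=\prod_i\varepsilon_i^{\alpha_i}$. $v_\bullet^{\times\alpha}$ is the list in which each $v_i$ is repeated $\alpha_i$ times. $\Delta^\alpha(p;x;v_\bullet)=\Delta(p;x;v_\bullet^{\times\alpha})$, where $\Delta(p;x;w_1,\dots,w_n)=\sum_{S\subseteq[n]}(-1)^{n-|S|}p(x+\sum_{i\in S}w_i)$. $D^\alpha(p;x;v_\bullet)=D(p;x;v_\bullet^{\times\alpha})$, where $D(p;x;w_1,\dots,w_n)$ is the coefficient of $\varepsilon_1\cdots\varepsilon_n$ in $p(x+\sum_i\varepsilon_iw_i)$ computed in $R[\varepsilon_1,\dots,\varepsilon_n]/(\varepsilon_i^2)$; as $\mathbb{Q}\subseteq R$ it equals the iterated directional derivative $(D_{v_1}^{\alpha_1}\cdots D_{v_k}^{\alpha_k}p)(x)$.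 *)

theory Defs
  imports Complex_Main "HOL-Library.Poly_Mapping" "HOL-Library.FuncSet" "HOL-Algebra.QuotRing"
begin

text \<open>
  Conventions. Indices start at 0. Multi-indices in \<open>\<nat>\<^sup>k\<close> and vectors in \<open>R\<^sup>d\<close> are functions on
  \<^typ>\<open>nat\<close> of which only the values at \<open>i < k\<close> (resp. \<open>j < d\<close>) are ever used; a family
  \<open>v\<^sub>1, \<dots>, v\<^sub>k\<close> of vectors is a function \<open>v\<close> with \<open>v i j\<close> the \<open>j\<close>-th coordinate of the
  \<open>i\<close>-th vector.
\<close>

text \<open>
  \<^bold>\<open>The hypothesis that \<open>R\<close> contains the rationals.\<close> The embedding is unique if it exists.
\<close>

definition rat_embedding :: "(rat \<Rightarrow> 'r::comm_ring_1) \<Rightarrow> bool" where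
  "rat_embedding \<phi> \<longleftrightarrow>
     \<phi> 1 = 1 \<and> (\<forall>a b. \<phi> (a + b) = \<phi> a + \<phi> b) \<and> (\<forall>a b. \<phi> (a * b) = \<phi> a * \<phi> b) \<and> inj \<phi>"

text \<open>
  \<^bold>\<open>Multi-indices.\<close> \<open>box k \<nu>\<close> is the set of multi-indices \<open>0 \<le> \<alpha> \<le> \<nu>\<close>, each represented once
  (extensional functions on \<open>{..<k}\<close>).
\<close>

definition box :: "nat \<Rightarrow> (nat \<Rightarrow> nat) \<Rightarrow> (nat \<Rightarrow> nat) set" where
  "box k \<nu> = (\<Pi>\<^sub>E i\<in>{..<k}. {..\<nu> i})"

definition wt :: "nat \<Rightarrow> (nat \<Rightarrow> nat) \<Rightarrow> nat" where
  "wt k \<alpha> = (\<Sum>i<k. \<alpha> i)"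

definition mfact :: "nat \<Rightarrow> (nat \<Rightarrow> nat) \<Rightarrow> nat" where
  "mfact k \<alpha> = (\<Prod>i<k. fact (\<alpha> i))"

definition ffact :: "'a::comm_ring_1 \<Rightarrow> nat \<Rightarrow> 'a" where
  "ffact a n = (\<Prod>j<n. a - of_nat j)"

definition mffact :: "nat \<Rightarrow> (nat \<Rightarrow> 'a::comm_ring_1) \<Rightarrow> (nat \<Rightarrow> nat) \<Rightarrow> 'a" where
  "mffact k a \<beta> = (\<Prod>i<k. ffact (a i) (\<beta> i))"

definition mpow :: "nat \<Rightarrow> (nat \<Rightarrow> 'a::comm_ring_1) \<Rightarrow> (nat \<Rightarrow> nat) \<Rightarrow> 'a" where
  "mpow k a \<alpha> = (\<Prod>i<k. a i ^ \<alpha> i)"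

definition mcoef :: "nat \<Rightarrow> (nat \<Rightarrow> nat) \<Rightarrow> (nat \<Rightarrow> nat) \<Rightarrow> rat" where
  "mcoef k \<alpha> \<beta> = mffact k (\<lambda>i. of_nat (\<alpha> i)) \<beta> / of_nat (mfact k \<beta>)"

text \<open>
  \<^bold>\<open>Polynomials.\<close> A polynomial over \<open>R\<close> in variables indexed by \<^typ>\<open>nat\<close> is a finitely supported
  function from monomials (finitely supported exponent functions) to \<open>R\<close>, with the
  convolution product; \<open>mpoly_ring n\<close> is the subring \<open>R[X\<^sub>0, \<dots>, X\<^sub>n\<^sub>-\<^sub>1]\<close>.
\<close>

type_synonym 'r mpoly = "(nat \<Rightarrow>\<^sub>0 nat) \<Rightarrow>\<^sub>0 'r"

definition Const :: "'r::comm_ring_1 \<Rightarrow> 'r mpoly" where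
  "Const c = Poly_Mapping.single 0 c"

definition Var :: "nat \<Rightarrow> 'r::comm_ring_1 mpoly" where
  "Var i = Poly_Mapping.single (Poly_Mapping.single i 1) 1"

definition mpoly_ring :: "nat \<Rightarrow> 'r::comm_ring_1 mpoly ring" where
  "mpoly_ring n =
     \<lparr>carrier = {f. \<forall>m\<in>Poly_Mapping.keys f. Poly_Mapping.keys m \<subseteq> {..<n}},
      mult = (*), one = 1, zero = 0, add = (+)\<rparr>"

text \<open>
  Evaluation of a polynomial over \<open>R\<close> at a point with coordinates in an \<open>R\<close>-algebra with
  structure map \<open>\<iota>\<close>.
\<close>

definition eval_mpoly :: "('r \<Rightarrow> 'a) \<Rightarrow> 'r::comm_ring_1 mpoly \<Rightarrow> (nat \<Rightarrow> 'a::comm_ring_1) \<Rightarrow> 'a" where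
  "eval_mpoly \<iota> p z =
     (\<Sum>m\<in>Poly_Mapping.keys p.
        \<iota> (Poly_Mapping.lookup p m) * (\<Prod>j\<in>Poly_Mapping.keys m. z j ^ Poly_Mapping.lookup m j))"

text \<open>
  \<^bold>\<open>Grid and Taylor algebra.\<close> \<open>grid_class k \<nu> f\<close> and \<open>taylor_class k \<nu> f\<close> are the residue classes
  of a polynomial \<open>f\<close>. The residue map is a ring homomorphism (shown below), so an expression
  in the residue classes of the variables is the residue class of the same expression
  in the variables themselves.
\<close>

definition grid_ideal :: "nat \<Rightarrow> (nat \<Rightarrow> nat) \<Rightarrow> 'r::comm_ring_1 mpoly set" where
  "grid_ideal k \<nu> = Idl\<^bsub>mpoly_ring k\<^esub> {ffact (Var i) (\<nu> i + 1) |i. i < k}"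

definition grid_algebra :: "nat \<Rightarrow> (nat \<Rightarrow> nat) \<Rightarrow> 'r::comm_ring_1 mpoly set ring" where
  "grid_algebra k \<nu> = mpoly_ring k Quot grid_ideal k \<nu>"

definition grid_class :: "nat \<Rightarrow> (nat \<Rightarrow> nat) \<Rightarrow> 'r::comm_ring_1 mpoly \<Rightarrow> 'r mpoly set" where
  "grid_class k \<nu> f = grid_ideal k \<nu> +>\<^bsub>mpoly_ring k\<^esub> f"

definition taylor_ideal :: "nat \<Rightarrow> (nat \<Rightarrow> nat) \<Rightarrow> 'r::comm_ring_1 mpoly set" where
  "taylor_ideal k \<nu> = Idl\<^bsub>mpoly_ring k\<^esub> {Var i ^ (\<nu> i + 1) |i. i < k}"

definition taylor_algebra :: "nat \<Rightarrow> (nat \<Rightarrow> nat) \<Rightarrow> 'r::comm_ring_1 mpoly set ring" where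
  "taylor_algebra k \<nu> = mpoly_ring k Quot taylor_ideal k \<nu>"

definition taylor_class :: "nat \<Rightarrow> (nat \<Rightarrow> nat) \<Rightarrow> 'r::comm_ring_1 mpoly \<Rightarrow> 'r mpoly set" where
  "taylor_class k \<nu> f = taylor_ideal k \<nu> +>\<^bsub>mpoly_ring k\<^esub> f"

text \<open>
  The coefficient of the monomial \<open>m\<close> (with \<open>m \<le> \<nu>\<close>) of an element \<open>C\<close> of the Taylor algebra,
  with respect to the \<open>R\<close>-basis of monomials \<open>\<le> \<nu>\<close>: it is read off from the
  representative of \<open>C\<close> that is supported on those monomials.
\<close>

definition taylor_coeff ::
    "nat \<Rightarrow> (nat \<Rightarrow> nat) \<Rightarrow> 'r::comm_ring_1 mpoly set \<Rightarrow> (nat \<Rightarrow>\<^sub>0 nat) \<Rightarrow> 'r" where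
  "taylor_coeff k \<nu> C m =
     (THE c. \<exists>q\<in>C. (\<forall>m'\<in>Poly_Mapping.keys q. \<forall>i<k. Poly_Mapping.lookup m' i \<le> \<nu> i)
                 \<and> c = Poly_Mapping.lookup q m)"

text \<open>\<^bold>\<open>Differences and derivatives.\<close> The lists \<open>ws\<close> below are lists of vectors.\<close>

definition mrep :: "nat \<Rightarrow> (nat \<Rightarrow> nat) \<Rightarrow> (nat \<Rightarrow> 'v) \<Rightarrow> 'v list" where
  "mrep k \<alpha> v = concat (map (\<lambda>i. replicate (\<alpha> i) (v i)) [0..<k])"

definition Delta :: "'r::comm_ring_1 mpoly \<Rightarrow> (nat \<Rightarrow> 'r) \<Rightarrow> (nat \<Rightarrow> 'r) list \<Rightarrow> 'r" where
  "Delta p x ws =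
     (\<Sum>S\<in>Pow {..<length ws}.
        (-1) ^ (length ws - card S) * eval_mpoly id p (\<lambda>j. x j + (\<Sum>i\<in>S. (ws ! i) j)))"

text \<open>The ring \<open>R[\<epsilon>\<^sub>1, \<dots>, \<epsilon>\<^sub>n] / (\<epsilon>\<^sub>i\<^sup>2)\<close> is the Taylor algebra for \<open>\<nu> = (1, \<dots>, 1)\<close>.\<close>

definition Deriv :: "'r::comm_ring_1 mpoly \<Rightarrow> (nat \<Rightarrow> 'r) \<Rightarrow> (nat \<Rightarrow> 'r) list \<Rightarrow> 'r" where
  "Deriv p x ws = (let n = length ws in
     taylor_coeff n (\<lambda>_. 1)
       (taylor_class n (\<lambda>_. 1)
          (eval_mpoly Const p (\<lambda>j. Const (x j) + (\<Sum>i<n. Var i * Const ((ws ! i) j)))))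
       (\<Sum>i<n. Poly_Mapping.single i 1))"

definition mDelta ::
    "nat \<Rightarrow> (nat \<Rightarrow> nat) \<Rightarrow> 'r::comm_ring_1 mpoly \<Rightarrow> (nat \<Rightarrow> 'r) \<Rightarrow> (nat \<Rightarrow> nat \<Rightarrow> 'r) \<Rightarrow> 'r" where
  "mDelta k \<alpha> p x v = Delta p x (mrep k \<alpha> v)"

definition mDeriv ::
    "nat \<Rightarrow> (nat \<Rightarrow> nat) \<Rightarrow> 'r::comm_ring_1 mpoly \<Rightarrow> (nat \<Rightarrow> 'r) \<Rightarrow> (nat \<Rightarrow> nat \<Rightarrow> 'r) \<Rightarrow> 'r" where
  "mDeriv k \<alpha> p x v = Deriv p x (mrep k \<alpha> v)"

text \<open>\<^bold>\<open>The algebras are quotient rings and the residue maps are ring homomorphisms.\<close>\<close>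

lemma mem_mpoly_ring:
  "f \<in> carrier (mpoly_ring n) \<longleftrightarrow> (\<forall>m\<in>Poly_Mapping.keys f. Poly_Mapping.keys m \<subseteq> {..<n})"
  by (simp add: mpoly_ring_def)

lemma mpoly_ring_simps:
  "mult (mpoly_ring n) = (*)" "one (mpoly_ring n) = 1"
  "zero (mpoly_ring n) = 0" "add (mpoly_ring n) = (+)"
  by (simp_all add: mpoly_ring_def)

lemma mpoly_ring_closed:
  shows "0 \<in> carrier (mpoly_ring n)" "1 \<in> carrier (mpoly_ring n)"
    and "Const c \<in> carrier (mpoly_ring n)" "i < n \<Longrightarrow> Var i \<in> carrier (mpoly_ring n)"
    and "f \<in> carrier (mpoly_ring n) \<Longrightarrow> - f \<in> carrier (mpoly_ring n)"
    and "f \<in> carrier (mpoly_ring n) \<Longrightarrow> g \<in> carrier (mpoly_ring n) \<Longrightarrow> f + g \<in> carrier (mpoly_ring n)"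
    and "f \<in> carrier (mpoly_ring n) \<Longrightarrow> g \<in> carrier (mpoly_ring n) \<Longrightarrow> f * g \<in> carrier (mpoly_ring n)"
proof -
  show "f * g \<in> carrier (mpoly_ring n)"
    if "f \<in> carrier (mpoly_ring n)" "g \<in> carrier (mpoly_ring n)"
    unfolding mem_mpoly_ring
  proof
    fix m assume "m \<in> Poly_Mapping.keys (f * g)"
    then obtain a b where "m = a + b" "a \<in> Poly_Mapping.keys f" "b \<in> Poly_Mapping.keys g"
      using keys_mult[of f g] by blast
    then show "Poly_Mapping.keys m \<subseteq> {..<n}"
      using that keys_add[of a b] unfolding mem_mpoly_ring by blast
  qed
  show "f + g \<in> carrier (mpoly_ring n)"
    if "f \<in> carrier (mpoly_ring n)" "g \<in> carrier (mpoly_ring n)"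
    using that keys_add[of f g] unfolding mem_mpoly_ring by blast
qed (auto simp: mem_mpoly_ring Const_def Var_def split: if_splits)

lemma cring_mpoly_ring: "cring (mpoly_ring n)"
proof (intro cringI abelian_groupI comm_monoidI, unfold mpoly_ring_simps)
  fix f :: "'a mpoly" assume "f \<in> carrier (mpoly_ring n)"
  then show "\<exists>g\<in>carrier (mpoly_ring n). g + f = 0"
    by (intro bexI[of _ "- f"]) (auto intro: mpoly_ring_closed)
qed (auto intro: mpoly_ring_closed simp: algebra_simps)

lemma power_closed:
  "f \<in> carrier (mpoly_ring n) \<Longrightarrow> f ^ r \<in> carrier (mpoly_ring n)"
  by (induction r) (auto intro: mpoly_ring_closed)

lemma ffact_closed:
  assumes "f \<in> carrier (mpoly_ring n)"
  shows "ffact f r \<in> carrier (mpoly_ring n)"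
proof -
  have of_nat: "of_nat j \<in> carrier (mpoly_ring n)" for j
    by (induction j) (auto intro: mpoly_ring_closed)
  have minus: "f - of_nat j \<in> carrier (mpoly_ring n)" for j
    using mpoly_ring_closed(6)[OF assms mpoly_ring_closed(5)[OF of_nat[of j]]] by simp
  show ?thesis
    unfolding ffact_def by (induction r) (auto intro: mpoly_ring_closed minus)
qed

lemma ideal_grid_ideal: "ideal (grid_ideal k \<nu>) (mpoly_ring k)"
  unfolding grid_ideal_def
  by (rule ring.genideal_ideal[OF cring.axioms(1)[OF cring_mpoly_ring]])
     (auto intro: ffact_closed mpoly_ring_closed)

lemma ideal_taylor_ideal: "ideal (taylor_ideal k \<nu>) (mpoly_ring k)"
  unfolding taylor_ideal_def
  by (rule ring.genideal_ideal[OF cring.axioms(1)[OF cring_mpoly_ring]])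
     (auto intro: power_closed mpoly_ring_closed simp del: power_Suc)

lemma grid_class_hom: "grid_class k \<nu> \<in> ring_hom (mpoly_ring k) (grid_algebra k \<nu>)"
  unfolding grid_class_def[abs_def] grid_algebra_def
  by (rule ideal.rcos_ring_hom[OF ideal_grid_ideal])

lemma taylor_class_hom: "taylor_class k \<nu> \<in> ring_hom (mpoly_ring k) (taylor_algebra k \<nu>)"
  unfolding taylor_class_def[abs_def] taylor_algebra_def
  by (rule ideal.rcos_ring_hom[OF ideal_taylor_ideal])

end

theory Submission
  imports Defs "HOL-Combinatorics.Stirling"
begin

text \<open>
  Let \<open>q\<close> be the pullback of \<open>p\<close> along \<open>\<epsilon> \<mapsto> x + \<Sum>\<^sub>i \<epsilon>\<^sub>i v\<^sub>i\<close>, a polynomial in \<open>k\<close> variables. The left-hand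
  sides of the two expansions are the residue classes of \<open>q\<close>, and substitution gives
  \<open>p(x + \<Sum>\<^sub>i z\<^sub>i v\<^sub>i) = q(z)\<close> (\<open>eval_affine_pullback\<close>). All four claims are therefore claims about \<open>q\<close>.

  Differences and derivatives are expressed in terms of \<open>q\<close>. Counting the sets of
  positions in the list \<open>v\<^sup>\<times>\<^sup>\<alpha>\<close> by the numbers of their elements in the blocks of equal vectors gives
  \<open>\<Delta>\<^sup>\<alpha> = \<Sum>\<^sub>\<beta> (-1)\<^sup>w\<^sup>t\<^sup>(\<^sup>\<alpha>\<^sup>-\<^sup>\<beta>\<^sup>) \<Prod>\<^sub>i (\<alpha>\<^sub>i choose \<beta>\<^sub>i) q(\<beta>)\<close> (\<open>mDelta_eq_binomial_sum\<close>), the second claim. Extracting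
  the coefficient of a squarefree monomial from powers of sums of variables shows that
  \<open>D\<^sup>\<alpha> / \<alpha>!\<close> is the coefficient of \<open>\<epsilon>\<^sup>\<alpha>\<close> in \<open>q\<close> (\<open>mDeriv_eq_fact_coeff\<close>). As the Taylor ideal consists of the
  polynomials none of whose monomials divides \<open>\<epsilon>\<^sup>\<nu>\<close>, the Taylor expansion follows.

  The other two claims are linear in \<open>q\<close>, and on a monomial \<open>\<epsilon>\<^sup>m\<close> a sum over a box is a product of sums
  in one variable. These are given by the Stirling numbers of the second kind, which are the
  coefficients of \<open>t\<^sup>n\<close> with respect to falling factorials (\<open>power_eq_Stirling_sum\<close>) and satisfy
  \<open>\<Sum>\<^sub>b (-1)\<^sup>a\<^sup>-\<^sup>b (a choose b) b\<^sup>n = a! S(n, a)\<close> (\<open>alternating_binomial_sum_Stirling\<close>). Hence \<open>\<Delta>\<^sup>\<alpha> / \<alpha>!\<close> of the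
  monomial \<open>\<delta>\<^sup>m\<close> is \<open>\<Prod>\<^sub>i S(m\<^sub>i, \<alpha>\<^sub>i)\<close>, its coefficient at \<open>(\<delta>)\<^sub>\<alpha>\<close>, and the grid ideal contains the
  remaining falling factorials. In the Taylor algebra, the alternating sum of the scaled
  polynomials multiplies \<open>\<epsilon>\<^sup>m\<close> by \<open>\<nu>! \<Prod>\<^sub>i S(m\<^sub>i, \<nu>\<^sub>i)\<close>. This is zero if some \<open>m\<^sub>i < \<nu>\<^sub>i\<close>, and \<open>\<epsilon>\<^sup>m\<close> is zero if
  some \<open>m\<^sub>i > \<nu>\<^sub>i\<close>, so that only \<open>m = \<nu>\<close> remains, with the factor \<open>\<nu>!\<close>.
\<close>

section \<open>Stirling numbers and differences of powers\<close>

text \<open>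
  The left-hand side is the \<open>a\<close>-th difference of \<open>t\<^sup>n\<close> at \<open>0\<close>. Absorbing a factor \<open>b\<close> into the
  binomial coefficient and applying Pascal's rule shows that it satisfies the recurrence of
  \<open>a! S(n, a)\<close>. The cases \<open>n < a\<close>, \<open>n = a\<close> and \<open>n > a\<close> are what separates the three kinds of
  monomials in the scaling identity for the Taylor algebra.
\<close>

lemma alternating_binomial_sum_Stirling:
  "(\<Sum>b\<le>a. (-1) ^ (a - b) * of_nat (a choose b) * of_nat b ^ n :: 'a::comm_ring_1)
     = of_nat (fact a * Stirling n a)"
proof (induction n arbitrary: a)
  case 0
  have "(\<Sum>b\<le>a. (-1) ^ (a - b) * of_nat (a choose b) * of_nat b ^ 0 :: 'a) = (1 + (-1)) ^ a"
    unfolding binomial_ring by (simp add: mult.commute)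
  also have "\<dots> = of_nat (fact a * Stirling 0 a)"
    by (cases a) simp_all
  finally show ?case .
next
  case (Suc n)
  define c :: "nat \<Rightarrow> 'a" where
    "c a = (\<Sum>b\<le>a. (-1) ^ (a - b) * of_nat (a choose b) * of_nat b ^ n)" for a
  show ?case
  proof (cases a)
    case 0
    then show ?thesis by simp
  next
    case (Suc a')
    \<comment> \<open>The difference of order \<open>a'\<close> at \<open>1\<close>: it is \<open>c a' + c (a' + 1)\<close>, and absorption gives \<open>(a' + 1) s\<close>.\<close>
    define s :: 'a where
      "s = (\<Sum>b\<le>a'. (-1) ^ (a' - b) * of_nat (a' choose b) * of_nat (Suc b) ^ n)"
    have "(\<Sum>b\<le>a. (-1) ^ (a - b) * of_nat (a choose b) * of_nat b ^ Suc n)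
        = (\<Sum>b\<le>a'. (-1) ^ (a' - b) * of_nat ((Suc a' choose Suc b) * Suc b) * of_nat (Suc b) ^ n :: 'a)"
      unfolding Suc by (subst sum.atMost_Suc_shift) (simp add: algebra_simps)
    also have "\<dots> = of_nat (Suc a') * s"
      unfolding Suc_times_binomial_eq[symmetric] s_def sum_distrib_left
      by (intro sum.cong) (simp_all add: algebra_simps)
    also have "s = c a' + c (Suc a')"
    proof -
      have "c (Suc a') = (-1) ^ Suc a' * of_nat 0 ^ n
          + (\<Sum>b\<le>a'. (-1) ^ (a' - b) * of_nat (a' choose Suc b) * of_nat (Suc b) ^ n) + s"
        unfolding c_def s_def
        by (subst sum.atMost_Suc_shift) (simp add: algebra_simps sum.distrib)
      also have "(\<Sum>b\<le>a'. (-1) ^ (a' - b) * of_nat (a' choose Suc b) * of_nat (Suc b) ^ n)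
          = - (\<Sum>b<a'. (-1) ^ (a' - Suc b) * of_nat (a' choose Suc b) * of_nat (Suc b) ^ n :: 'a)"
      proof -
        have "(-1 :: 'a) ^ (a' - b) = - ((-1) ^ (a' - Suc b))" if "b < a'" for b
          using that by (simp add: Suc_diff_Suc[symmetric])
        then show ?thesis
          by (simp add: lessThan_Suc_atMost[symmetric] sum_negf[symmetric] binomial_eq_0)
      qed
      finally have "c (Suc a') = s - (\<Sum>b<Suc a'. (-1) ^ (a' - b) * of_nat (a' choose b) * of_nat b ^ n)"
        by (subst sum.lessThan_Suc_shift) simp
      then show ?thesis
        by (simp add: c_def lessThan_Suc_atMost)
    qed
    finally show ?thesis
      using Suc.IH[of a'] Suc.IH[of "Suc a'"] unfolding c_def[symmetric]
      by (simp add: Suc algebra_simps)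
  qed
qed

lemma ffact_Suc: "ffact a (Suc n) = ffact a n * (a - of_nat n)"
  by (simp add: ffact_def)

text \<open>
  Multiplying a falling factorial by \<open>a = (a - j) + j\<close> either raises its order or multiplies it
  by \<open>j\<close>; collecting the terms gives the recurrence of the Stirling numbers.
\<close>

lemma power_eq_Stirling_sum:
  "(a::'a::comm_ring_1) ^ n = (\<Sum>j\<le>n. of_nat (Stirling n j) * ffact a j)"
proof (induction n)
  case 0
  show ?case by (simp add: ffact_def)
next
  case (Suc n)
  have "a ^ Suc n = (\<Sum>j\<le>n. of_nat (Stirling n j) * (ffact a j * a))"
    by (simp add: Suc sum_distrib_left algebra_simps)
  also have "\<dots> = (\<Sum>j\<le>n. of_nat (Stirling n j) * ffact a (Suc j))
                 + (\<Sum>j\<le>n. of_nat (j * Stirling n j) * ffact a j)"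
    unfolding sum.distrib[symmetric]
    by (intro sum.cong) (simp_all add: ffact_Suc algebra_simps)
  also have "(\<Sum>j\<le>n. of_nat (j * Stirling n j) * ffact a j)
           = (\<Sum>j\<le>Suc n. of_nat (j * Stirling n j) * ffact a j)"
    by simp
  also have "\<dots> = (\<Sum>j\<le>n. of_nat (Suc j * Stirling n (Suc j)) * ffact a (Suc j))"
    by (subst sum.atMost_Suc_shift) simp
  also have "(\<Sum>j\<le>n. of_nat (Stirling n j) * ffact a (Suc j)) + \<dots>
           = (\<Sum>j\<le>Suc n. of_nat (Stirling (Suc n) j) * ffact a j)"
    unfolding sum.atMost_Suc_shift[of _ n] by (simp add: sum.distrib[symmetric] algebra_simps)
  finally show ?case .
qed

section \<open>Evaluation of polynomials\<close>

lemma sum_monomials: "(\<Sum>m\<in>Poly_Mapping.keys f. Poly_Mapping.single m (Poly_Mapping.lookup f m)) = f"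
  by (rule poly_mapping_eqI)
     (auto simp: lookup_sum lookup_single when_def in_keys_iff sum.delta')

lemma eval_mpoly_superset:
  assumes "\<iota> 0 = 0" "finite A" "Poly_Mapping.keys p \<subseteq> A"
  shows "eval_mpoly \<iota> p z =
    (\<Sum>m\<in>A. \<iota> (Poly_Mapping.lookup p m) * (\<Prod>j\<in>Poly_Mapping.keys m. z j ^ Poly_Mapping.lookup m j))"
  unfolding eval_mpoly_def using assms
  by (intro sum.mono_neutral_left) (auto simp: in_keys_iff)

lemma monomial_value_superset:
  fixes z :: "nat \<Rightarrow> 'a::comm_ring_1"
  assumes "finite J" "Poly_Mapping.keys m \<subseteq> J"
  shows "(\<Prod>j\<in>Poly_Mapping.keys m. z j ^ Poly_Mapping.lookup m j) = (\<Prod>j\<in>J. z j ^ Poly_Mapping.lookup m j)"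
  using assms by (intro prod.mono_neutral_left) (auto simp: in_keys_iff)

lemma monomial_value_add:
  fixes z :: "nat \<Rightarrow> 'a::comm_ring_1"
  shows "(\<Prod>j\<in>Poly_Mapping.keys (a + b). z j ^ Poly_Mapping.lookup (a + b) j)
   = (\<Prod>j\<in>Poly_Mapping.keys a. z j ^ Poly_Mapping.lookup a j)
     * (\<Prod>j\<in>Poly_Mapping.keys b. z j ^ Poly_Mapping.lookup b j)"
proof -
  let ?J = "Poly_Mapping.keys a \<union> Poly_Mapping.keys b"
  have "(\<Prod>j\<in>Poly_Mapping.keys m. z j ^ Poly_Mapping.lookup m j) = (\<Prod>j\<in>?J. z j ^ Poly_Mapping.lookup m j)"
    if "Poly_Mapping.keys m \<subseteq> ?J" for m
    using that by (intro monomial_value_superset) auto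
  from this[of a] this[of b] this[of "a + b"] show ?thesis
    using keys_add[of a b] by (simp only: Un_upper1 Un_upper2 lookup_add power_add prod.distrib)
qed

text \<open>
  Evaluation is used with two structure maps: the identity of \<open>R\<close> for the values at grid points,
  and the embedding \<open>Const\<close> of \<open>R\<close> in a polynomial ring for the substitution of polynomials.
\<close>

locale coefficient_hom =
  fixes \<iota> :: "'r::comm_ring_1 \<Rightarrow> 'a::comm_ring_1"
  assumes hom_zero: "\<iota> 0 = 0" and hom_one: "\<iota> 1 = 1"
    and hom_add: "\<iota> (a + b) = \<iota> a + \<iota> b" and hom_mult: "\<iota> (a * b) = \<iota> a * \<iota> b"
begin

lemma eval_zero: "eval_mpoly \<iota> 0 z = 0"
  by (simp add: eval_mpoly_def)

lemma eval_add: "eval_mpoly \<iota> (f + g) z = eval_mpoly \<iota> f z + eval_mpoly \<iota> g z"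
proof -
  let ?A = "Poly_Mapping.keys f \<union> Poly_Mapping.keys g"
  have "eval_mpoly \<iota> h z = (\<Sum>m\<in>?A. \<iota> (Poly_Mapping.lookup h m) *
          (\<Prod>j\<in>Poly_Mapping.keys m. z j ^ Poly_Mapping.lookup m j))"
    if "Poly_Mapping.keys h \<subseteq> ?A" for h
    using that by (intro eval_mpoly_superset hom_zero) auto
  then show ?thesis
    using keys_add[of f g] by (simp add: lookup_add hom_add distrib_right sum.distrib)
qed

lemma eval_sum: "eval_mpoly \<iota> (\<Sum>i\<in>S. f i) z = (\<Sum>i\<in>S. eval_mpoly \<iota> (f i) z)"
  by (induction S rule: infinite_finite_induct) (simp_all add: eval_zero eval_add)

lemma eval_single:
  "eval_mpoly \<iota> (Poly_Mapping.single m c) z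
     = \<iota> c * (\<Prod>j\<in>Poly_Mapping.keys m. z j ^ Poly_Mapping.lookup m j)"
  by (subst eval_mpoly_superset[of _ "{m}"]) (simp_all add: hom_zero)

lemma eval_mult: "eval_mpoly \<iota> (f * g) z = eval_mpoly \<iota> f z * eval_mpoly \<iota> g z"
proof -
  have "f * g = (\<Sum>a\<in>Poly_Mapping.keys f. \<Sum>b\<in>Poly_Mapping.keys g.
      Poly_Mapping.single (a + b) (Poly_Mapping.lookup f a * Poly_Mapping.lookup g b))"
  proof -
    have "f * g = (\<Sum>a\<in>Poly_Mapping.keys f. Poly_Mapping.single a (Poly_Mapping.lookup f a))
        * (\<Sum>b\<in>Poly_Mapping.keys g. Poly_Mapping.single b (Poly_Mapping.lookup g b))"
      by (simp only: sum_monomials)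
    then show ?thesis by (simp only: sum_product mult_single)
  qed
  then show ?thesis
    unfolding eval_mpoly_def[of \<iota> f] eval_mpoly_def[of \<iota> g]
    by (simp add: eval_sum eval_single hom_mult monomial_value_add sum_product mult_ac)
qed

lemma eval_Const: "eval_mpoly \<iota> (Const c) z = \<iota> c"
  by (simp add: Const_def eval_single)

lemma eval_Var: "eval_mpoly \<iota> (Var i) z = z i"
  by (simp add: Var_def eval_single hom_one)

lemma eval_prod: "eval_mpoly \<iota> (\<Prod>i\<in>S. f i) z = (\<Prod>i\<in>S. eval_mpoly \<iota> (f i) z)"
  by (induction S rule: infinite_finite_induct)
     (simp_all add: eval_mult eval_Const[of 1, unfolded Const_def, simplified] hom_one)

lemma eval_power: "eval_mpoly \<iota> (f ^ n) z = eval_mpoly \<iota> f z ^ n"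
  using eval_prod[of "\<lambda>_. f" "{..<n}" z] by simp

end

lemma Const_hom:
  "Const 0 = 0" "Const 1 = 1" "Const (a + b) = Const a + Const b" "Const (a * b) = Const a * Const b"
  by (simp_all add: Const_def single_add mult_single)

lemma Const_of_nat: "Const (of_nat n) = of_nat n"
  by (simp add: Const_def)

lemma Const_sum: "Const (\<Sum>i\<in>S. f i) = (\<Sum>i\<in>S. Const (f i))"
  by (induction S rule: infinite_finite_induct) (simp_all add: Const_hom)

interpretation id_hom: coefficient_hom "id :: 'r::comm_ring_1 \<Rightarrow> 'r"
  by unfold_locales simp_all

interpretation Const_hom: coefficient_hom "Const :: 'r::comm_ring_1 \<Rightarrow> 'r mpoly"
  by unfold_locales (simp_all add: Const_hom)

text \<open>
  The pullback of \<open>p\<close> along the affine map \<open>\<epsilon> \<mapsto> x + \<Sum>\<^sub>i \<epsilon>\<^sub>i v\<^sub>i\<close>, a polynomial in the \<open>k\<close> parameters.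
  It determines all values, differences and derivatives of \<open>p\<close> in the directions \<open>v\<^sub>i\<close>, and both
  expansions are statements about its monomials.
\<close>

definition affine_pullback ::
    "nat \<Rightarrow> 'r::comm_ring_1 mpoly \<Rightarrow> (nat \<Rightarrow> 'r) \<Rightarrow> (nat \<Rightarrow> nat \<Rightarrow> 'r) \<Rightarrow> 'r mpoly" where
  "affine_pullback k p x v = eval_mpoly Const p (\<lambda>j. Const (x j) + (\<Sum>i<k. Var i * Const (v i j)))"

text \<open>
  Composition of substitutions. It holds because evaluation at \<open>z\<close> is a ring homomorphism that
  maps \<open>Const c\<close> to \<open>\<iota> c\<close> and the \<open>i\<close>-th variable to \<open>z i\<close>.
\<close>

lemma (in coefficient_hom) eval_affine_pullback:
  "eval_mpoly \<iota> (affine_pullback k p x v) z = eval_mpoly \<iota> p (\<lambda>j. \<iota> (x j) + (\<Sum>i<k. z i * \<iota> (v i j)))"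
  unfolding affine_pullback_def eval_mpoly_def[of Const] eval_mpoly_def[of \<iota> p]
  by (simp add: eval_sum eval_mult eval_prod eval_power eval_add eval_Const eval_Var)

lemma sum_closed:
  "(\<And>i. i \<in> S \<Longrightarrow> f i \<in> carrier (mpoly_ring n)) \<Longrightarrow> (\<Sum>i\<in>S. f i) \<in> carrier (mpoly_ring n)"
  by (induction S rule: infinite_finite_induct) (auto intro: mpoly_ring_closed)

lemma prod_closed:
  "(\<And>i. i \<in> S \<Longrightarrow> f i \<in> carrier (mpoly_ring n)) \<Longrightarrow> (\<Prod>i\<in>S. f i) \<in> carrier (mpoly_ring n)"
  by (induction S rule: infinite_finite_induct) (auto intro: mpoly_ring_closed)

lemma of_nat_closed: "of_nat j \<in> carrier (mpoly_ring n)"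
  by (induction j) (auto intro: mpoly_ring_closed)

lemma minus_closed:
  "f \<in> carrier (mpoly_ring n) \<Longrightarrow> g \<in> carrier (mpoly_ring n) \<Longrightarrow> f - g \<in> carrier (mpoly_ring n)"
  using mpoly_ring_closed(6)[of f n "- g"] mpoly_ring_closed(5)[of g n] by simp

lemmas closed = sum_closed prod_closed of_nat_closed minus_closed power_closed ffact_closed
  mpoly_ring_closed

lemma mffact_closed: "mffact k Var \<alpha> \<in> carrier (mpoly_ring k)"
  unfolding mffact_def by (intro closed) auto

lemma mpow_closed: "mpow k Var \<alpha> \<in> carrier (mpoly_ring k)"
  unfolding mpow_def by (intro closed) auto

lemma eval_closed:
  assumes "\<And>j. z j \<in> carrier (mpoly_ring n)"
  shows "eval_mpoly Const p z \<in> carrier (mpoly_ring n)"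
  unfolding eval_mpoly_def by (intro closed assms)

lemma affine_pullback_closed: "affine_pullback k p x v \<in> carrier (mpoly_ring k)"
  unfolding affine_pullback_def by (intro eval_closed closed) auto

lemma lookup_Const_mult: "Poly_Mapping.lookup (Const c * f) m = c * Poly_Mapping.lookup f m"
  by (simp add: Const_def mult_map_scale_conv_mult[symmetric] map.rep_eq when_def)

lemma eval_mpoly_ring:
  fixes z :: "nat \<Rightarrow> 'a::comm_ring_1"
  assumes "q \<in> carrier (mpoly_ring k)"
  shows "eval_mpoly \<iota> q z =
    (\<Sum>m\<in>Poly_Mapping.keys q. \<iota> (Poly_Mapping.lookup q m) * (\<Prod>i<k. z i ^ Poly_Mapping.lookup m i))"
  unfolding eval_mpoly_def
proof (intro sum.cong refl arg_cong2[of _ _ _ _ "(*)"])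
  fix m assume "m \<in> Poly_Mapping.keys q"
  with assms have "Poly_Mapping.keys m \<subseteq> {..<k}" by (simp add: mem_mpoly_ring)
  then show "(\<Prod>j\<in>Poly_Mapping.keys m. z j ^ Poly_Mapping.lookup m j) = (\<Prod>i<k. z i ^ Poly_Mapping.lookup m i)"
    by (intro monomial_value_superset) auto
qed

lemma power_Var: "Var i ^ n = Poly_Mapping.single (Poly_Mapping.single i n) 1"
  by (induction n) (simp_all add: Var_def mult_single single_add[symmetric] add.commute)

lemma prod_single:
  "(\<Prod>i\<in>S. Poly_Mapping.single (g i) 1) = Poly_Mapping.single (\<Sum>i\<in>S. g i :: nat \<Rightarrow>\<^sub>0 nat) (1::'r::comm_ring_1)"
  by (induction S rule: infinite_finite_induct) (simp_all add: mult_single)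

lemma eval_mpoly_Var: "eval_mpoly Const q Var = q"
  unfolding eval_mpoly_def power_Var prod_single
  by (simp add: Const_def mult_single sum_monomials)

section \<open>Congruences in the grid algebra and the Taylor algebra\<close>

lemma ring_mpoly_ring: "ring (mpoly_ring n)"
  by (rule cring.axioms(1)[OF cring_mpoly_ring])

lemma a_inv_mpoly_ring: "f \<in> carrier (mpoly_ring n) \<Longrightarrow> \<ominus>\<^bsub>mpoly_ring n\<^esub> f = - f"
  using abelian_group.minus_equality[OF ring.is_abelian_group[OF ring_mpoly_ring[of n]], of "- f" f]
  by (simp add: mpoly_ring_simps closed)

text \<open>
  Congruences modulo an ideal, in terms of the type class operations on polynomials.
\<close>

locale mpoly_ideal =
  fixes k :: nat and I :: "'r::comm_ring_1 mpoly set"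
  assumes is_ideal: "ideal I (mpoly_ring k)"
begin

lemma coset_eqI:
  assumes "f \<in> carrier (mpoly_ring k)" "g \<in> carrier (mpoly_ring k)" "f - g \<in> I"
  shows "I +>\<^bsub>mpoly_ring k\<^esub> f = I +>\<^bsub>mpoly_ring k\<^esub> g"
proof -
  have "f \<ominus>\<^bsub>mpoly_ring k\<^esub> g = f - g"
    using assms by (simp add: a_minus_def a_inv_mpoly_ring mpoly_ring_simps)
  with assms show ?thesis
    using ring.quotient_eq_iff_same_a_r_cos[OF ring_mpoly_ring is_ideal assms(1,2)] by simp
qed

lemma zero_mem: "0 \<in> I"
  using additive_subgroup.zero_closed[OF ideal.axioms(1)[OF is_ideal]] by (simp add: mpoly_ring_simps)

lemma add_mem: "f \<in> I \<Longrightarrow> g \<in> I \<Longrightarrow> f + g \<in> I"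
  using additive_subgroup.a_closed[OF ideal.axioms(1)[OF is_ideal]] by (simp add: mpoly_ring_simps)

lemma sum_mem: "(\<And>i. i \<in> S \<Longrightarrow> f i \<in> I) \<Longrightarrow> (\<Sum>i\<in>S. f i) \<in> I"
  by (induction S rule: infinite_finite_induct) (auto intro: zero_mem add_mem)

lemma mult_mem: "f \<in> carrier (mpoly_ring k) \<Longrightarrow> g \<in> I \<Longrightarrow> f * g \<in> I"
  using ideal.I_l_closed[OF is_ideal] by (simp add: mpoly_ring_simps)

text \<open>
  Lets the two expansions of a product of powers be compared one variable at a time, without
  products in the quotient ring.
\<close>

lemma prod_diff_mem:
  assumes "\<And>i. i \<in> S \<Longrightarrow> f i \<in> carrier (mpoly_ring k)"
    and "\<And>i. i \<in> S \<Longrightarrow> g i \<in> carrier (mpoly_ring k)"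
    and "\<And>i. i \<in> S \<Longrightarrow> f i - g i \<in> I"
  shows "(\<Prod>i\<in>S. f i) - (\<Prod>i\<in>S. g i) \<in> I"
  using assms
proof (induction S rule: infinite_finite_induct)
  case (insert a S)
  have "(\<Prod>i\<in>insert a S. f i) - (\<Prod>i\<in>insert a S. g i)
      = f a * ((\<Prod>i\<in>S. f i) - (\<Prod>i\<in>S. g i)) + (\<Prod>i\<in>S. g i) * (f a - g a)"
    using insert by (simp add: algebra_simps)
  also have "\<dots> \<in> I"
    using insert by (intro add_mem mult_mem closed) auto
  finally show ?case .
qed (simp_all add: zero_mem)

end

interpretation grid: mpoly_ideal k "grid_ideal k \<nu>" for k \<nu>
  by (intro mpoly_ideal.intro ideal_grid_ideal)

interpretation taylor: mpoly_ideal k "taylor_ideal k \<nu>" for k \<nu>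
  by (intro mpoly_ideal.intro ideal_taylor_ideal)

text \<open>
  A falling factorial is a multiple of every falling factorial of smaller order.
\<close>

lemma ffact_mem_grid_ideal:
  assumes "i < k" "\<nu> i < a"
  shows "(ffact (Var i) a :: 'r::comm_ring_1 mpoly) \<in> grid_ideal k \<nu>"
proof -
  have gen: "(ffact (Var i) (\<nu> i + 1) :: 'r mpoly) \<in> grid_ideal k \<nu>"
    unfolding grid_ideal_def using assms(1)
    by (intro subsetD[OF ring.genideal_self[OF ring_mpoly_ring]]) (auto intro: closed)
  have "(ffact (Var i) (\<nu> i + 1 + j) :: 'r mpoly) \<in> grid_ideal k \<nu>" for j
  proof (induction j)
    case (Suc j)
    then show ?case
      using grid.mult_mem[of "Var i - of_nat (\<nu> i + 1 + j)" k "ffact (Var i) (\<nu> i + 1 + j)" \<nu>] assms(1)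
      by (simp add: ffact_Suc closed mult.commute del: of_nat_Suc of_nat_add)
  qed (use gen in simp)
  from this[of "a - (\<nu> i + 1)"] assms(2) show ?thesis by simp
qed

lemma finite_box: "finite (box k \<nu>)"
  unfolding box_def by (intro finite_PiE) auto

definition box_monomial :: "nat \<Rightarrow> (nat \<Rightarrow> nat) \<Rightarrow> (nat \<Rightarrow>\<^sub>0 nat)" where
  "box_monomial k \<alpha> = (\<Sum>i<k. Poly_Mapping.single i (\<alpha> i))"

lemma lookup_box_monomial: "Poly_Mapping.lookup (box_monomial k \<alpha>) i = (if i < k then \<alpha> i else 0)"
  by (simp add: box_monomial_def lookup_sum lookup_single when_def sum.delta)

lemma eq_box_monomial_iff:
  assumes "Poly_Mapping.keys m \<subseteq> {..<k}"
  shows "m = box_monomial k \<alpha> \<longleftrightarrow> (\<forall>i<k. Poly_Mapping.lookup m i = \<alpha> i)"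
  using assms by (auto simp: poly_mapping_eq_iff fun_eq_iff lookup_box_monomial in_keys_iff subset_iff)

lemma mpow_Var: "mpow k Var \<alpha> = Poly_Mapping.single (box_monomial k \<alpha>) 1"
  by (simp add: mpow_def power_Var prod_single box_monomial_def)

text \<open>
  The Taylor ideal is a monomial ideal, so membership is a condition on each monomial. For the
  inclusion from left to right, the polynomials satisfying this condition form an ideal that
  contains the generators; conversely, each such monomial is a multiple of a generator.
\<close>

lemma mem_taylor_ideal_iff:
  "(f :: 'r::comm_ring_1 mpoly) \<in> taylor_ideal k \<nu> \<longleftrightarrow>
     f \<in> carrier (mpoly_ring k) \<and>
     (\<forall>m\<in>Poly_Mapping.keys f. \<exists>i<k. \<nu> i < Poly_Mapping.lookup m i)" (is "_ \<longleftrightarrow> f \<in> ?C \<and> ?P f")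
proof
  assume "f \<in> taylor_ideal k \<nu>"
  moreover have "taylor_ideal k \<nu> \<subseteq> {f \<in> ?C. ?P f}"
    unfolding taylor_ideal_def
  proof (intro ring.genideal_minimal ring_mpoly_ring idealI)
    show "subgroup {f \<in> ?C. ?P f} (add_monoid (mpoly_ring k))"
    proof (unfold_locales, goal_cases)
      case (2 f g)
      then show ?case using keys_add[of f g] by (auto simp: mpoly_ring_simps closed)
    next
      case (4 f)
      then show ?case
        using a_inv_mpoly_ring[of f k, unfolded a_inv_def] by (auto simp: closed)
    qed (auto simp: mpoly_ring_simps closed)
  next
    fix f g assume *: "f \<in> {f \<in> ?C. ?P f}" "g \<in> ?C"
    have "?P (g * f)"
    proof
      fix m assume "m \<in> Poly_Mapping.keys (g * f)"
      then obtain a b where m: "m = a + b" "b \<in> Poly_Mapping.keys f"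
        using keys_mult[of g f] by blast
      with * obtain i where "i < k" "\<nu> i < Poly_Mapping.lookup b i" by auto
      with m show "\<exists>i<k. \<nu> i < Poly_Mapping.lookup m i"
        by (auto simp: lookup_add intro!: exI[of _ i])
    qed
    with * show "g \<otimes>\<^bsub>mpoly_ring k\<^esub> f \<in> {f \<in> ?C. ?P f}" "f \<otimes>\<^bsub>mpoly_ring k\<^esub> g \<in> {f \<in> ?C. ?P f}"
      by (auto simp: mpoly_ring_simps closed mult.commute)
  next
    have "?P (Var i ^ (\<nu> i + 1))" if "i < k" for i
      using that by (auto simp: power_Var intro!: exI[of _ i] simp del: power_Suc)
    then show "{Var i ^ (\<nu> i + 1) |i. i < k} \<subseteq> {f \<in> ?C. ?P f}"
      by (auto intro: closed simp del: power_Suc)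
  qed
  ultimately show "f \<in> ?C \<and> ?P f" by blast
next
  assume f: "f \<in> ?C \<and> ?P f"
  have "Poly_Mapping.single m (Poly_Mapping.lookup f m) \<in> taylor_ideal k \<nu>" if m: "m \<in> Poly_Mapping.keys f" for m
  proof -
    from f m obtain i where i: "i < k" "\<nu> i < Poly_Mapping.lookup m i" by blast
    define r where "r = m - Poly_Mapping.single i (\<nu> i + 1)"
    have mr: "m = r + Poly_Mapping.single i (\<nu> i + 1)"
      using i by (intro poly_mapping_eqI) (auto simp: r_def lookup_add lookup_minus lookup_single when_def)
    have "Poly_Mapping.single m (Poly_Mapping.lookup f m)
        = Poly_Mapping.single r (Poly_Mapping.lookup f m) * Var i ^ (\<nu> i + 1)"
      using mr by (simp add: power_Var mult_single del: power_Suc)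
    moreover have "Var i ^ (\<nu> i + 1) \<in> taylor_ideal k \<nu>"
      unfolding taylor_ideal_def using i
      by (intro subsetD[OF ring.genideal_self[OF ring_mpoly_ring]]) (auto intro: closed simp del: power_Suc)
    moreover have "Poly_Mapping.keys r \<subseteq> Poly_Mapping.keys m"
      by (auto simp: r_def in_keys_iff lookup_minus)
    then have "Poly_Mapping.single r (Poly_Mapping.lookup f m) \<in> ?C"
      using f m by (auto simp: mem_mpoly_ring)
    ultimately show ?thesis by (metis taylor.mult_mem)
  qed
  then have "(\<Sum>m\<in>Poly_Mapping.keys f. Poly_Mapping.single m (Poly_Mapping.lookup f m)) \<in> taylor_ideal k \<nu>"
    by (rule taylor.sum_mem)
  then show "f \<in> taylor_ideal k \<nu>" by (simp add: sum_monomials)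
qed

text \<open>
  The box consists of the exponents of the monomials that do not lie in the ideal, so
  subtracting these terms leaves only monomials of the ideal.
\<close>

lemma taylor_expansion:
  fixes f :: "'r::comm_ring_1 mpoly"
  assumes f: "f \<in> carrier (mpoly_ring k)"
  shows "f - (\<Sum>\<alpha>\<in>box k \<nu>. Const (Poly_Mapping.lookup f (box_monomial k \<alpha>)) * mpow k Var \<alpha>)
           \<in> taylor_ideal k \<nu>" (is "f - ?T \<in> _")
  unfolding mem_taylor_ideal_iff
proof
  show C: "f - ?T \<in> carrier (mpoly_ring k)"
    by (intro closed f mpow_closed)
  show "\<forall>m\<in>Poly_Mapping.keys (f - ?T). \<exists>i<k. \<nu> i < Poly_Mapping.lookup m i"
  proof (rule ccontr)
    assume "\<not> ?thesis"
    then obtain m where m: "m \<in> Poly_Mapping.keys (f - ?T)" "\<forall>i<k. Poly_Mapping.lookup m i \<le> \<nu> i"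
      by (meson not_less)
    have keys: "Poly_Mapping.keys m \<subseteq> {..<k}"
      using C m by (simp add: mem_mpoly_ring)
    define \<mu> where "\<mu> = restrict (Poly_Mapping.lookup m) {..<k}"
    have \<mu>: "\<mu> \<in> box k \<nu>" using m by (auto simp: \<mu>_def box_def)
    have eq: "box_monomial k \<alpha> = m \<longleftrightarrow> \<alpha> = \<mu>" if "\<alpha> \<in> box k \<nu>" for \<alpha>
    proof -
      have "box_monomial k \<alpha> = m \<longleftrightarrow> (\<forall>i<k. Poly_Mapping.lookup m i = \<alpha> i)"
        using eq_box_monomial_iff[OF keys] by metis
      also have "\<dots> \<longleftrightarrow> \<alpha> = \<mu>"
        using that PiE_ext[OF that[unfolded box_def] \<mu>[unfolded box_def]] by (auto simp: \<mu>_def)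
      finally show ?thesis .
    qed
    have "Poly_Mapping.lookup ?T m
        = (\<Sum>\<alpha>\<in>box k \<nu>. if \<alpha> = \<mu> then Poly_Mapping.lookup f m else 0)"
      unfolding lookup_sum lookup_Const_mult mpow_Var lookup_single
      using eq eq[OF \<mu>] by (intro sum.cong) (auto simp: when_def)
    also have "\<dots> = Poly_Mapping.lookup f m"
      using \<mu> finite_box by simp
    finally show False
      using m by (simp add: in_keys_iff lookup_minus)
  qed
qed

lemma mem_taylor_class: "q \<in> taylor_class k \<nu> f \<longleftrightarrow> q - f \<in> taylor_ideal k \<nu>"
  by (auto simp: taylor_class_def a_r_coset_def' mpoly_ring_simps intro!: bexI[of _ "q - f"])

text \<open>
  Any two representatives of a class differ by a combination of monomials that do not divide
  \<open>\<epsilon>\<^sup>\<nu>\<close>, so every representative has the same coefficient at \<open>m\<close>. A reduced representative, which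
  the definition of the coefficient asks for, is the truncation of \<open>f\<close>.
\<close>

lemma taylor_coeff_class:
  fixes f :: "'r::comm_ring_1 mpoly"
  assumes f: "f \<in> carrier (mpoly_ring k)" and m: "\<forall>i<k. Poly_Mapping.lookup m i \<le> \<nu> i"
  shows "taylor_coeff k \<nu> (taylor_class k \<nu> f) m = Poly_Mapping.lookup f m"
proof -
  define T where "T = (\<Sum>\<alpha>\<in>box k \<nu>. Const (Poly_Mapping.lookup f (box_monomial k \<alpha>)) * mpow k Var \<alpha>)"
  have "f - T \<in> taylor_ideal k \<nu>"
    unfolding T_def by (rule taylor_expansion[OF f])
  then have "T - f \<in> taylor_ideal k \<nu>"
    using taylor.mult_mem[of "- 1" k "f - T" \<nu>] by (simp add: closed)
  then have T: "T \<in> taylor_class k \<nu> f"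
    by (simp add: mem_taylor_class)
  have T_reduced: "\<forall>m'\<in>Poly_Mapping.keys T. \<forall>i<k. Poly_Mapping.lookup m' i \<le> \<nu> i"
  proof
    fix m' assume "m' \<in> Poly_Mapping.keys T"
    then obtain \<alpha> where "\<alpha> \<in> box k \<nu>" "m' = box_monomial k \<alpha>"
      unfolding T_def in_keys_iff lookup_sum lookup_Const_mult mpow_Var lookup_single
      by (elim sum.not_neutral_contains_not_neutral) (auto simp: when_def split: if_splits)
    then show "\<forall>i<k. Poly_Mapping.lookup m' i \<le> \<nu> i"
      by (auto simp: lookup_box_monomial box_def)
  qed
  have coeff: "Poly_Mapping.lookup q m = Poly_Mapping.lookup f m" if "q \<in> taylor_class k \<nu> f" for q
  proof -
    have "m \<notin> Poly_Mapping.keys (q - f)"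
      using that m unfolding mem_taylor_class mem_taylor_ideal_iff by (meson not_less)
    then show ?thesis by (simp add: in_keys_iff lookup_minus)
  qed
  show ?thesis
    unfolding taylor_coeff_def
  proof (rule the_equality)
    show "\<exists>q\<in>taylor_class k \<nu> f. (\<forall>m'\<in>Poly_Mapping.keys q. \<forall>i<k. Poly_Mapping.lookup m' i \<le> \<nu> i)
        \<and> Poly_Mapping.lookup f m = Poly_Mapping.lookup q m"
      using T T_reduced coeff[OF T] by (intro bexI[of _ T]) auto
  qed (use coeff in auto)
qed

section \<open>Lists of repeated vectors\<close>

text \<open>
  The list \<open>v\<^sup>\<times>\<^sup>\<alpha>\<close> is read through the list of the indices of its entries: \<open>block k \<alpha> i\<close> is the set of
  the \<open>\<alpha> i\<close> positions at which \<open>v\<^sub>i\<close> stands, and these blocks partition the positions.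
\<close>

abbreviation index_list :: "nat \<Rightarrow> (nat \<Rightarrow> nat) \<Rightarrow> nat list" where
  "index_list k \<alpha> \<equiv> mrep k \<alpha> (\<lambda>i. i)"

definition block :: "nat \<Rightarrow> (nat \<Rightarrow> nat) \<Rightarrow> nat \<Rightarrow> nat set" where
  "block k \<alpha> i = {t. t < wt k \<alpha> \<and> index_list k \<alpha> ! t = i}"

lemma mrep_eq_map: "mrep k \<alpha> v = map v (index_list k \<alpha>)"
  by (simp add: mrep_def map_concat o_def)

lemma length_index_list: "length (index_list k \<alpha>) = wt k \<alpha>"
  by (induction k) (simp_all add: mrep_def wt_def)

lemma length_mrep: "length (mrep k \<alpha> v) = wt k \<alpha>"
  by (simp add: mrep_eq_map[of _ _ v] length_index_list)

lemma set_index_list: "set (index_list k \<alpha>) \<subseteq> {..<k}"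
  by (auto simp: mrep_def)

lemma index_list_nth_less: "t < wt k \<alpha> \<Longrightarrow> index_list k \<alpha> ! t < k"
  using set_index_list[of k \<alpha>] nth_mem[of t "index_list k \<alpha>"] by (force simp: length_index_list)

lemma mrep_nth: "t < wt k \<alpha> \<Longrightarrow> mrep k \<alpha> v ! t = v (index_list k \<alpha> ! t)"
  by (simp add: mrep_eq_map[of _ _ v] length_index_list)

lemma finite_block: "finite (block k \<alpha> i)"
  by (simp add: block_def)

lemma disjoint_block: "i \<noteq> j \<Longrightarrow> block k \<alpha> i \<inter> block k \<alpha> j = {}"
  by (auto simp: block_def)

lemma Union_block: "(\<Union>i<k. block k \<alpha> i) = {..<wt k \<alpha>}"
  using index_list_nth_less by (auto simp: block_def)

lemma card_block:
  assumes "i < k"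
  shows "card (block k \<alpha> i) = \<alpha> i"
proof -
  have "length (filter (\<lambda>y. y = i) (index_list n \<alpha>)) = (if i < n then \<alpha> i else 0)" for n
  proof (induction n)
    case (Suc n)
    have "index_list (Suc n) \<alpha> = index_list n \<alpha> @ replicate (\<alpha> n) n"
      by (simp add: mrep_def)
    with Suc show ?case by (auto simp: less_Suc_eq filter_replicate)
  qed (simp add: mrep_def)
  with assms show ?thesis
    by (simp add: length_filter_conv_card length_index_list block_def)
qed

text \<open>
  Grouping a linear combination of the entries of \<open>v\<^sup>\<times>\<^sup>\<alpha>\<close> by blocks. It is used with all
  coefficients equal to \<open>1\<close> for differences, and with independent variables as coefficients
  for derivatives.
\<close>

lemma sum_mrep:
  fixes v :: "nat \<Rightarrow> nat \<Rightarrow> 'a::comm_ring_1"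
  assumes "S \<subseteq> {..<wt k \<alpha>}"
  shows "(\<Sum>t\<in>S. c t * f (mrep k \<alpha> v ! t)) = (\<Sum>i<k. (\<Sum>t\<in>S \<inter> block k \<alpha> i. c t) * (f (v i) :: 'b::comm_ring_1))"
proof -
  have "(\<Sum>t\<in>S. c t * f (mrep k \<alpha> v ! t)) = (\<Sum>t\<in>(\<Union>i<k. S \<inter> block k \<alpha> i). c t * f (mrep k \<alpha> v ! t))"
    using assms Union_block[of k \<alpha>] by (intro sum.cong) auto
  also have "\<dots> = (\<Sum>i<k. \<Sum>t\<in>S \<inter> block k \<alpha> i. c t * f (mrep k \<alpha> v ! t))"
    using disjoint_block finite_block by (intro sum.UNION_disjoint) fastforce+
  also have "\<dots> = (\<Sum>i<k. (\<Sum>t\<in>S \<inter> block k \<alpha> i. c t) * f (v i))"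
    unfolding sum_distrib_right by (intro sum.cong) (auto simp: block_def mrep_nth)
  finally show ?thesis .
qed

text \<open>
  A set of positions is the union of its traces on the blocks, which can be chosen
  independently of each other.
\<close>

lemma card_subsets_meeting_blocks:
  "card {S. S \<subseteq> {..<wt k \<alpha>} \<and> (\<forall>i<k. card (S \<inter> block k \<alpha> i) = \<beta> i)} = (\<Prod>i<k. \<alpha> i choose \<beta> i)"
proof -
  let ?T = "block k \<alpha>"
  let ?F = "\<Pi>\<^sub>E i\<in>{..<k}. {W. W \<subseteq> ?T i \<and> card W = \<beta> i}"
  let ?X = "{S. S \<subseteq> {..<wt k \<alpha>} \<and> (\<forall>i<k. card (S \<inter> ?T i) = \<beta> i)}"
  have inv: "(\<Union>j<k. Z j) \<inter> ?T i = Z i" if "Z \<in> ?F" "i < k" for Z i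
    using that disjoint_block[of _ i k \<alpha>] by (fastforce dest: PiE_mem)
  have "bij_betw (\<lambda>S. \<lambda>i\<in>{..<k}. S \<inter> ?T i) ?X ?F"
  proof (rule bij_betw_byWitness[where f' = "\<lambda>Z. \<Union>i<k. Z i"])
    show "\<forall>S\<in>?X. (\<Union>i<k. (\<lambda>i\<in>{..<k}. S \<inter> ?T i) i) = S"
      using Union_block[of k \<alpha>] by fastforce
    show "\<forall>Z\<in>?F. (\<lambda>i\<in>{..<k}. (\<Union>i<k. Z i) \<inter> ?T i) = Z"
    proof
      fix Z assume Z: "Z \<in> ?F"
      show "(\<lambda>i\<in>{..<k}. (\<Union>i<k. Z i) \<inter> ?T i) = Z"
      proof
        fix i show "(\<lambda>i\<in>{..<k}. (\<Union>i<k. Z i) \<inter> ?T i) i = Z i"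
          using inv[OF Z, of i] PiE_arb[OF Z, of i] by (cases "i < k") simp_all
      qed
    qed
    show "(\<lambda>S. \<lambda>i\<in>{..<k}. S \<inter> ?T i) ` ?X \<subseteq> ?F" by auto
    show "(\<lambda>Z. \<Union>i<k. Z i) ` ?F \<subseteq> ?X"
    proof clarify
      fix Z assume Z: "Z \<in> ?F"
      have "(\<Union>i<k. Z i) \<subseteq> {..<wt k \<alpha>}"
        using Z Union_block[of k \<alpha>] by (fastforce dest: PiE_mem)
      moreover have "card ((\<Union>i<k. Z i) \<inter> ?T i) = \<beta> i" if "i < k" for i
        using inv[OF Z that] Z that by (auto dest: PiE_mem)
      ultimately show "(\<Union>i<k. Z i) \<subseteq> {..<wt k \<alpha>} \<and> (\<forall>i<k. card ((\<Union>i<k. Z i) \<inter> ?T i) = \<beta> i)"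
        by blast
    qed
  qed
  then have "card ?X = card ?F" by (rule bij_betw_same_card)
  also have "\<dots> = (\<Prod>i<k. \<alpha> i choose \<beta> i)"
    by (simp add: card_PiE n_subsets finite_block card_block)
  finally show ?thesis .
qed

section \<open>Differences as binomial sums\<close>

lemma wt_diff:
  assumes "\<beta> \<in> box k \<alpha>"
  shows "wt k (\<lambda>i. \<alpha> i - \<beta> i) = wt k \<alpha> - wt k \<beta>"
  using assms unfolding wt_def box_def by (intro sum_subtractf_nat) auto

text \<open>
  The summand of a set \<open>S\<close> of positions depends only on the numbers of elements that \<open>S\<close> has
  in the blocks, so the sum over sets is a sum over such profiles \<open>\<beta>\<close>, weighted by the number of
  sets with profile \<open>\<beta>\<close>.
\<close>

lemma mDelta_eq_binomial_sum:
  "mDelta k \<alpha> p x v = (\<Sum>\<beta>\<in>box k \<alpha>. (-1) ^ wt k (\<lambda>i. \<alpha> i - \<beta> i) *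
      of_nat (\<Prod>i<k. \<alpha> i choose \<beta> i) * eval_mpoly id p (\<lambda>j. x j + (\<Sum>i<k. of_nat (\<beta> i) * v i j)))"
proof -
  let ?T = "block k \<alpha>" and ?U = "{..<wt k \<alpha>}"
  let ?val = "\<lambda>\<beta>. eval_mpoly id p (\<lambda>j. x j + (\<Sum>i<k. of_nat (\<beta> i) * v i j))"
  let ?term = "\<lambda>\<beta>. (-1) ^ wt k (\<lambda>i. \<alpha> i - \<beta> i) * ?val \<beta>"
  define profile where "profile S = (\<lambda>i\<in>{..<k}. card (S \<inter> ?T i))" for S
  have profile: "profile S \<in> box k \<alpha>" for S
    unfolding profile_def box_def
    by (auto simp: card_block[symmetric] finite_block intro!: card_mono)
  have card: "card S = wt k (profile S)" if "S \<subseteq> ?U" for S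
  proof -
    have "card S = card (\<Union>i<k. S \<inter> ?T i)"
      using that Union_block[of k \<alpha>] by (intro arg_cong[of _ _ card]) auto
    also have "\<dots> = (\<Sum>i<k. card (S \<inter> ?T i))"
      using disjoint_block finite_block by (intro card_UN_disjoint) fastforce+
    finally show ?thesis by (simp add: wt_def profile_def)
  qed
  have point: "(\<Sum>t\<in>S. (mrep k \<alpha> v ! t) j) = (\<Sum>i<k. of_nat (profile S i) * v i j)" if "S \<subseteq> ?U" for S j
    using sum_mrep[OF that, of "\<lambda>_. 1" "\<lambda>w. w j" v] by (simp add: profile_def)
  have "mDelta k \<alpha> p x v = (\<Sum>S\<in>Pow ?U. ?term (profile S))"
    unfolding mDelta_def Delta_def length_mrep
    by (intro sum.cong) (auto simp: point card wt_diff[OF profile])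
  also have "\<dots> = (\<Sum>\<beta>\<in>box k \<alpha>. \<Sum>S\<in>{S \<in> Pow ?U. profile S = \<beta>}. ?term (profile S))"
    using profile by (intro sum.group[symmetric] finite_box) auto
  also have "\<dots> = (\<Sum>\<beta>\<in>box k \<alpha>. of_nat (\<Prod>i<k. \<alpha> i choose \<beta> i) * ?term \<beta>)"
  proof (intro sum.cong refl)
    fix \<beta> assume \<beta>: "\<beta> \<in> box k \<alpha>"
    have "profile S = \<beta> \<longleftrightarrow> (\<forall>i<k. card (S \<inter> ?T i) = \<beta> i)" for S
    proof
      assume "\<forall>i<k. card (S \<inter> ?T i) = \<beta> i"
      then show "profile S = \<beta>"
        by (intro PiE_ext[OF profile[unfolded box_def] \<beta>[unfolded box_def]]) (simp add: profile_def)
    qed (auto simp: profile_def)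
    then have "{S \<in> Pow ?U. profile S = \<beta>} = {S. S \<subseteq> ?U \<and> (\<forall>i<k. card (S \<inter> ?T i) = \<beta> i)}"
      by auto
    then have "card {S \<in> Pow ?U. profile S = \<beta>} = (\<Prod>i<k. \<alpha> i choose \<beta> i)"
      by (simp only: card_subsets_meeting_blocks)
    then show "(\<Sum>S\<in>{S \<in> Pow ?U. profile S = \<beta>}. ?term (profile S))
        = of_nat (\<Prod>i<k. \<alpha> i choose \<beta> i) * ?term \<beta>"
      by simp
  qed
  finally show ?thesis by (simp add: mult_ac)
qed

section \<open>Derivatives as coefficients\<close>

definition sqfree :: "nat set \<Rightarrow> (nat \<Rightarrow>\<^sub>0 nat)" where
  "sqfree A = (\<Sum>t\<in>A. Poly_Mapping.single t 1)"

lemma lookup_sqfree: "finite A \<Longrightarrow> Poly_Mapping.lookup (sqfree A) j = (if j \<in> A then 1 else 0)"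
  by (simp add: sqfree_def lookup_sum lookup_single when_def)

lemma lookup_Var_mult_sqfree:
  assumes "finite A"
  shows "Poly_Mapping.lookup (Var t * g) (sqfree A)
    = (if t \<in> A then Poly_Mapping.lookup g (sqfree (A - {t})) else 0)"
proof -
  have eq: "Poly_Mapping.single t 1 + b = sqfree A \<longleftrightarrow> t \<in> A \<and> b = sqfree (A - {t})" for b
  proof
    assume *: "Poly_Mapping.single t 1 + b = sqfree A"
    have l: "Poly_Mapping.lookup b j + (if j = t then 1 else 0) = (if j \<in> A then 1 else 0)" for j
      using arg_cong[OF *, of "\<lambda>m. Poly_Mapping.lookup m j"] assms
      by (simp add: lookup_add lookup_single lookup_sqfree when_def eq_commute)
    have "t \<in> A" using l[of t] by (simp split: if_splits)
    moreover have "b = sqfree (A - {t})"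
    proof (rule poly_mapping_eqI)
      fix j
      show "Poly_Mapping.lookup b j = Poly_Mapping.lookup (sqfree (A - {t})) j"
        using l[of j] l[of t] assms by (simp add: lookup_sqfree split: if_splits)
    qed
    ultimately show "t \<in> A \<and> b = sqfree (A - {t})" ..
  qed (use assms in \<open>auto simp: sqfree_def sum.remove\<close>)
  have "Var t * g = (\<Sum>b\<in>Poly_Mapping.keys g. Poly_Mapping.single (Poly_Mapping.single t 1 + b) (Poly_Mapping.lookup g b))"
  proof -
    have "Var t * g = Var t * (\<Sum>b\<in>Poly_Mapping.keys g. Poly_Mapping.single b (Poly_Mapping.lookup g b))"
      by (simp only: sum_monomials)
    then show ?thesis by (simp only: Var_def sum_distrib_left mult_single mult_1)
  qed
  then have "Poly_Mapping.lookup (Var t * g) (sqfree A)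
      = (\<Sum>b\<in>Poly_Mapping.keys g. if t \<in> A \<and> b = sqfree (A - {t}) then Poly_Mapping.lookup g b else 0)"
    by (simp only: lookup_sum lookup_single when_def eq)
  also have "\<dots> = (if t \<in> A then Poly_Mapping.lookup g (sqfree (A - {t})) else 0)"
    by (auto simp: in_keys_iff)
  finally show ?thesis .
qed

text \<open>
  Modulo squares, \<open>(\<Sum>\<^sub>t \<epsilon>\<^sub>t)\<^sup>m\<close> is \<open>m!\<close> times the \<open>m\<close>-th elementary symmetric polynomial. If no variable
  from \<open>T\<close> occurs in the squarefree monomials of \<open>g\<close>, the power has to supply exactly the variables in \<open>A \<inter> T\<close>.
\<close>

lemma lookup_power_sum_Var_mult_sqfree:
  fixes g :: "'r::comm_ring_1 mpoly"
  assumes "finite T"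
    and g: "\<And>B. finite B \<Longrightarrow> B \<inter> T \<noteq> {} \<Longrightarrow> Poly_Mapping.lookup g (sqfree B) = 0"
    and "finite A"
  shows "Poly_Mapping.lookup ((\<Sum>t\<in>T. Var t) ^ m * g) (sqfree A)
    = (if card (A \<inter> T) = m then of_nat (fact m) * Poly_Mapping.lookup g (sqfree (A - T)) else 0)"
  using \<open>finite A\<close>
proof (induction m arbitrary: A)
  case 0
  then show ?case
    using g[of A] by (cases "A \<inter> T = {}") (auto simp: Diff_triv)
next
  case (Suc m)
  let ?h = "(\<Sum>t\<in>T. Var t) ^ m * g"
  have "Poly_Mapping.lookup ((\<Sum>t\<in>T. Var t) ^ Suc m * g) (sqfree A)
      = (\<Sum>t\<in>T. Poly_Mapping.lookup (Var t * ?h) (sqfree A))"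
    by (simp add: sum_distrib_right lookup_sum mult.assoc)
  also have "\<dots> = (\<Sum>t\<in>T. if t \<in> A then Poly_Mapping.lookup ?h (sqfree (A - {t})) else 0)"
    by (simp only: lookup_Var_mult_sqfree[OF Suc.prems])
  also have "\<dots> = (\<Sum>t\<in>A \<inter> T. Poly_Mapping.lookup ?h (sqfree (A - {t})))"
    by (simp only: Int_commute[of A] sum.inter_restrict[OF \<open>finite T\<close>])
  also have "\<dots> = (\<Sum>t\<in>A \<inter> T. if card (A \<inter> T) = Suc m
      then of_nat (fact m) * Poly_Mapping.lookup g (sqfree (A - T)) else 0)"
  proof (intro sum.cong refl)
    fix t assume t: "t \<in> A \<inter> T"
    have "(A - {t}) \<inter> T = A \<inter> T - {t}" "A - {t} - T = A - T" using t by auto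
    moreover have "card (A \<inter> T - {t}) = m \<longleftrightarrow> card (A \<inter> T) = Suc m"
      using t Suc.prems card_gt_0_iff[of "A \<inter> T"] by (auto simp: card_Diff_singleton)
    ultimately show "Poly_Mapping.lookup ?h (sqfree (A - {t})) = (if card (A \<inter> T) = Suc m
        then of_nat (fact m) * Poly_Mapping.lookup g (sqfree (A - T)) else 0)"
      using Suc by simp
  qed
  finally show ?case by (simp add: algebra_simps)
qed

text \<open>
  As the sets \<open>T i\<close> are disjoint, each variable in \<open>A\<close> can only come from the power of the one sum
  in which it occurs, so the coefficient is a product over the powers.
\<close>

lemma lookup_prod_power_sum_Var_sqfree:
  fixes T :: "nat \<Rightarrow> nat set"
  assumes T: "\<And>i. finite (T i)" "\<And>i j. i \<noteq> j \<Longrightarrow> T i \<inter> T j = {}" and "finite A"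
  shows "Poly_Mapping.lookup (\<Prod>i<k. (\<Sum>t\<in>T i. Var t) ^ m i :: 'r::comm_ring_1 mpoly) (sqfree A)
    = (if A \<subseteq> (\<Union>i<k. T i) \<and> (\<forall>i<k. card (A \<inter> T i) = m i) then of_nat (mfact k m) else 0)"
  using \<open>finite A\<close>
proof (induction k arbitrary: A)
  case 0
  have "sqfree A = 0 \<longleftrightarrow> A = {}"
  proof
    assume "sqfree A = 0"
    then have "Poly_Mapping.lookup (sqfree A) j = 0" for j by simp
    with lookup_sqfree[OF 0] show "A = {}" by (metis all_not_in_conv one_neq_zero)
  qed (simp add: sqfree_def)
  then show ?case
    by (simp add: mfact_def lookup_one when_def)
next
  case (Suc k)
  let ?g = "\<Prod>i<k. (\<Sum>t\<in>T i. Var t) ^ m i :: 'r mpoly"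
  have vanish: "Poly_Mapping.lookup ?g (sqfree B) = 0" if "finite B" "B \<inter> T k \<noteq> {}" for B
  proof -
    have "B \<inter> T k \<inter> T i = {}" if "i < k" for i
      using T(2)[of i k] that by blast
    with \<open>B \<inter> T k \<noteq> {}\<close> have "\<not> B \<subseteq> (\<Union>i<k. T i)" by blast
    then show ?thesis using Suc.IH[OF that(1)] by auto
  qed
  have sub: "A \<subseteq> (\<Union>i<Suc k. T i) \<longleftrightarrow> A - T k \<subseteq> (\<Union>i<k. T i)"
    by (auto simp: lessThan_Suc)
  have "(A - T k) \<inter> T i = A \<inter> T i" if "i < k" for i
    using T(2)[of i k] that by auto
  then have "Poly_Mapping.lookup ?g (sqfree (A - T k)) = (if A - T k \<subseteq> (\<Union>i<k. T i) \<and>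
      (\<forall>i<k. card (A \<inter> T i) = m i) then of_nat (mfact k m) else 0)"
    using Suc.IH[of "A - T k"] Suc.prems by simp
  with lookup_power_sum_Var_mult_sqfree[OF T(1) vanish Suc.prems, of k "m k"] show ?case
    unfolding sub by (auto simp: mult.commute less_Suc_eq mfact_def)
qed

text \<open>
  In the definition of the derivative, the variable \<open>\<epsilon>\<^sub>i\<close> of the pullback is replaced by the sum
  of the squarefree variables of the \<open>i\<close>-th block. A monomial \<open>\<epsilon>\<^sup>m\<close> then contributes to the coefficient
  of the product of all these variables only if \<open>m\<^sub>i\<close> is the size \<open>\<alpha>\<^sub>i\<close> of the block, for every \<open>i\<close>,
  and the contribution is \<open>\<alpha>!\<close>.
\<close>

lemma mDeriv_eq_fact_coeff:
  fixes p :: "'r::comm_ring_1 mpoly"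
  shows "mDeriv k \<alpha> p x v
    = of_nat (mfact k \<alpha>) * Poly_Mapping.lookup (affine_pullback k p x v) (box_monomial k \<alpha>)"
proof -
  let ?n = "wt k \<alpha>" and ?T = "block k \<alpha>" and ?q = "affine_pullback k p x v"
  define z :: "nat \<Rightarrow> 'r mpoly" where "z i = (\<Sum>t\<in>?T i. Var t)" for i
  let ?f = "eval_mpoly Const p (\<lambda>j. Const (x j) + (\<Sum>t<?n. Var t * Const ((mrep k \<alpha> v ! t) j)))"
  have "(\<Sum>t<?n. Var t * Const ((mrep k \<alpha> v ! t) j)) = (\<Sum>i<k. z i * Const (v i j))" for j
    using sum_mrep[of "{..<?n}" k \<alpha> Var "\<lambda>w. Const (w j)" v] Union_block[of k \<alpha>]
    by (simp add: z_def) (intro sum.cong arg_cong2[of _ _ _ _ "(*)"]; auto)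
  then have f: "?f = eval_mpoly Const ?q z"
    by (simp add: Const_hom.eval_affine_pullback)
  have "mDeriv k \<alpha> p x v = taylor_coeff ?n (\<lambda>_. 1) (taylor_class ?n (\<lambda>_. 1) ?f) (sqfree {..<?n})"
    by (simp add: mDeriv_def Deriv_def Let_def length_mrep sqfree_def)
  also have "\<dots> = Poly_Mapping.lookup ?f (sqfree {..<?n})"
    by (intro taylor_coeff_class eval_closed closed) (auto simp: lookup_sqfree)
  also have "\<dots> = (\<Sum>m\<in>Poly_Mapping.keys ?q. Poly_Mapping.lookup ?q m *
      Poly_Mapping.lookup (\<Prod>i<k. z i ^ Poly_Mapping.lookup m i) (sqfree {..<?n}))"
    unfolding f by (simp add: eval_mpoly_ring[OF affine_pullback_closed] lookup_sum lookup_Const_mult)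
  also have "\<dots> = (\<Sum>m\<in>Poly_Mapping.keys ?q. if m = box_monomial k \<alpha>
      then of_nat (mfact k \<alpha>) * Poly_Mapping.lookup ?q m else 0)"
  proof (intro sum.cong refl)
    fix m assume m: "m \<in> Poly_Mapping.keys ?q"
    have "Poly_Mapping.keys m \<subseteq> {..<k}"
      using affine_pullback_closed m unfolding mem_mpoly_ring by blast
    note eq = eq_box_monomial_iff[OF this, of \<alpha>]
    have "{..<?n} \<inter> ?T i = ?T i" for i by (auto simp: block_def)
    then have "Poly_Mapping.lookup (\<Prod>i<k. z i ^ Poly_Mapping.lookup m i) (sqfree {..<?n})
        = (if m = box_monomial k \<alpha> then of_nat (mfact k (Poly_Mapping.lookup m)) else 0)"
      unfolding z_def eq using Union_block[of k \<alpha>]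
      by (subst lookup_prod_power_sum_Var_sqfree) (auto simp: finite_block disjoint_block card_block)
    moreover have "mfact k (Poly_Mapping.lookup m) = mfact k \<alpha>" if "m = box_monomial k \<alpha>"
      using that eq by (simp add: mfact_def)
    ultimately show "Poly_Mapping.lookup ?q m *
        Poly_Mapping.lookup (\<Prod>i<k. z i ^ Poly_Mapping.lookup m i) (sqfree {..<?n})
      = (if m = box_monomial k \<alpha> then of_nat (mfact k \<alpha>) * Poly_Mapping.lookup ?q m else 0)"
      by simp
  qed
  also have "\<dots> = of_nat (mfact k \<alpha>) * Poly_Mapping.lookup ?q (box_monomial k \<alpha>)"
    by (simp add: in_keys_iff)
  finally show ?thesis .
qed

section \<open>The expansions\<close>

text \<open>
  The sum over a box of a product of functions of the single coordinates is the product of the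
  one-variable sums. The factors \<open>w\<close> are \<open>1\<close> for differences and the variables of the Taylor
  algebra for the scaling identity.
\<close>

lemma sum_box_binomial_power:
  fixes w :: "nat \<Rightarrow> 'a::comm_ring_1"
  shows "(\<Sum>\<beta>\<in>box k \<alpha>. (-1) ^ wt k (\<lambda>i. \<alpha> i - \<beta> i) * of_nat (\<Prod>i<k. \<alpha> i choose \<beta> i) *
      (\<Prod>i<k. (of_nat (\<beta> i) * w i) ^ m i))
    = of_nat (mfact k \<alpha>) * of_nat (\<Prod>i<k. Stirling (m i) (\<alpha> i)) * (\<Prod>i<k. w i ^ m i)"
proof -
  have "(\<Sum>\<beta>\<in>box k \<alpha>. (-1) ^ wt k (\<lambda>i. \<alpha> i - \<beta> i) * of_nat (\<Prod>i<k. \<alpha> i choose \<beta> i) *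
      (\<Prod>i<k. (of_nat (\<beta> i) * w i) ^ m i))
    = (\<Sum>\<beta>\<in>box k \<alpha>. \<Prod>i<k. (-1) ^ (\<alpha> i - \<beta> i) * of_nat (\<alpha> i choose \<beta> i) * of_nat (\<beta> i) ^ m i * w i ^ m i)"
    unfolding wt_def power_sum of_nat_prod prod.distrib[symmetric] power_mult_distrib
    by (intro sum.cong prod.cong) (simp_all add: mult.assoc)
  also have "\<dots> = (\<Prod>i<k. \<Sum>b\<le>\<alpha> i. (-1) ^ (\<alpha> i - b) * of_nat (\<alpha> i choose b) * of_nat b ^ m i * w i ^ m i)"
    unfolding box_def by (rule prod_sum_PiE[symmetric]) auto
  also have "\<dots> = (\<Prod>i<k. of_nat (fact (\<alpha> i) * Stirling (m i) (\<alpha> i)) * w i ^ m i)"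
    by (simp only: sum_distrib_right[symmetric] alternating_binomial_sum_Stirling)
  finally show ?thesis
    by (simp add: mfact_def prod.distrib)
qed

text \<open>
  The right-hand side is visibly \<open>\<alpha>!\<close> times an element of \<open>R\<close>, which makes the quotients by \<open>\<alpha>!\<close>
  in the grid expansion explicit.
\<close>

lemma mDelta_eq_Stirling_sum:
  "mDelta k \<alpha> p x v = of_nat (mfact k \<alpha>) *
     (\<Sum>m\<in>Poly_Mapping.keys (affine_pullback k p x v).
        Poly_Mapping.lookup (affine_pullback k p x v) m *
        of_nat (\<Prod>i<k. Stirling (Poly_Mapping.lookup m i) (\<alpha> i)))"
proof -
  let ?q = "affine_pullback k p x v"
  let ?c = "\<lambda>\<beta>. (-1) ^ wt k (\<lambda>i. \<alpha> i - \<beta> i) * of_nat (\<Prod>i<k. \<alpha> i choose \<beta> i)"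
  have "mDelta k \<alpha> p x v = (\<Sum>\<beta>\<in>box k \<alpha>. ?c \<beta> * eval_mpoly id ?q (\<lambda>i. of_nat (\<beta> i) * 1))"
    unfolding mDelta_eq_binomial_sum id_hom.eval_affine_pullback by simp
  also have "\<dots> = (\<Sum>\<beta>\<in>box k \<alpha>. \<Sum>m\<in>Poly_Mapping.keys ?q. Poly_Mapping.lookup ?q m *
      (?c \<beta> * (\<Prod>i<k. (of_nat (\<beta> i) * 1) ^ Poly_Mapping.lookup m i)))"
    unfolding eval_mpoly_ring[OF affine_pullback_closed] sum_distrib_left
    by (intro sum.cong) (simp_all add: mult_ac)
  also have "\<dots> = (\<Sum>m\<in>Poly_Mapping.keys ?q. Poly_Mapping.lookup ?q m *
      (\<Sum>\<beta>\<in>box k \<alpha>. ?c \<beta> * (\<Prod>i<k. (of_nat (\<beta> i) * 1) ^ Poly_Mapping.lookup m i)))"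
    unfolding sum_distrib_left by (rule sum.swap)
  finally show ?thesis
    by (simp only: sum_box_binomial_power) (simp add: sum_distrib_left mult_ac)
qed

lemma rat_embedding_of_nat:
  assumes "rat_embedding \<phi>"
  shows "\<phi> (of_nat n) = of_nat n"
proof -
  from assms have add: "\<phi> (a + b) = \<phi> a + \<phi> b" and "\<phi> 1 = 1" for a b
    by (auto simp: rat_embedding_def)
  with add[of 0 0] show ?thesis by (induction n) simp_all
qed

lemma rat_embedding_inverse_mfact:
  assumes "rat_embedding \<phi>"
  shows "\<phi> (1 / of_nat (mfact k \<alpha>)) * of_nat (mfact k \<alpha>) = 1"
proof -
  have "mfact k \<alpha> \<noteq> 0" by (simp add: mfact_def)
  then have "\<phi> (1 / of_nat (mfact k \<alpha>) * of_nat (mfact k \<alpha>)) = 1"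
    using assms by (simp add: rat_embedding_def)
  then show ?thesis
    using assms rat_embedding_of_nat[OF assms] by (simp only: rat_embedding_def)
qed

lemma mcoef_eq_binomial: "mcoef k \<alpha> \<beta> = of_nat (\<Prod>i<k. \<alpha> i choose \<beta> i)"
proof -
  have "ffact (of_nat (\<alpha> i)) (\<beta> i) / fact (\<beta> i) = (of_nat (\<alpha> i choose \<beta> i) :: rat)" for i
    by (simp add: binomial_gbinomial gbinomial_prod_rev ffact_def lessThan_atLeast0)
  then show ?thesis
    by (simp add: mcoef_def mffact_def mfact_def prod_dividef[symmetric])
qed

text \<open>
  The terms with \<open>a > \<nu>\<^sub>i\<close> in the expansion of \<open>\<delta>\<^sub>i\<^sup>n\<close> into falling factorials lie in the ideal,
  and those with \<open>a > n\<close> are zero.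
\<close>

lemma grid_power_Var:
  assumes "i < k"
  shows "Var i ^ n - (\<Sum>a\<le>\<nu> i. of_nat (Stirling n a) * ffact (Var i) a) \<in> grid_ideal k \<nu>"
proof -
  let ?g = "\<lambda>a. of_nat (Stirling n a) * ffact (Var i) a"
  let ?N = "max n (\<nu> i)"
  have "Var i ^ n = sum ?g {..?N}"
    unfolding power_eq_Stirling_sum by (intro sum.mono_neutral_left) auto
  then have "Var i ^ n - sum ?g {..\<nu> i} = sum ?g ({..?N} - {..\<nu> i})"
    by (simp add: sum_diff)
  also have "\<dots> \<in> grid_ideal k \<nu>"
    using assms by (intro grid.sum_mem grid.mult_mem ffact_mem_grid_ideal closed) auto
  finally show ?thesis .
qed

text \<open>
  On both sides a monomial \<open>\<delta>\<^sup>m\<close> of the pullback contributes a product over the coordinates, since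
  \<open>\<Delta>\<^sup>\<alpha> / \<alpha>!\<close> of it is \<open>\<Prod>\<^sub>i S(m\<^sub>i, \<alpha>\<^sub>i)\<close>. This reduces the claim to the powers of one variable.
\<close>

lemma grid_expansion:
  fixes p :: "'r::comm_ring_1 mpoly"
  assumes "rat_embedding \<phi>"
  shows "affine_pullback k p x v - (\<Sum>\<alpha>\<in>box k \<nu>. Const (\<phi> (1 / of_nat (mfact k \<alpha>)) * mDelta k \<alpha> p x v) * mffact k Var \<alpha>)
    \<in> grid_ideal k \<nu>"
proof -
  let ?q = "affine_pullback k p x v" and ?S = "\<lambda>m i a. of_nat (Stirling (Poly_Mapping.lookup m i) a)"
  have q: "?q = (\<Sum>m\<in>Poly_Mapping.keys ?q. Const (Poly_Mapping.lookup ?q m) * (\<Prod>i<k. Var i ^ Poly_Mapping.lookup m i))"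
    using eval_mpoly_ring[OF affine_pullback_closed, of Const k p x v Var] by (simp only: eval_mpoly_Var)
  have "\<phi> (1 / of_nat (mfact k \<alpha>)) * mDelta k \<alpha> p x v
      = (\<Sum>m\<in>Poly_Mapping.keys ?q. Poly_Mapping.lookup ?q m * of_nat (\<Prod>i<k. Stirling (Poly_Mapping.lookup m i) (\<alpha> i)))" for \<alpha>
    unfolding mDelta_eq_Stirling_sum mult.assoc[symmetric] rat_embedding_inverse_mfact[OF assms] mult_1 ..
  then have "(\<Sum>\<alpha>\<in>box k \<nu>. Const (\<phi> (1 / of_nat (mfact k \<alpha>)) * mDelta k \<alpha> p x v) * mffact k Var \<alpha>)
      = (\<Sum>\<alpha>\<in>box k \<nu>. \<Sum>m\<in>Poly_Mapping.keys ?q. Const (Poly_Mapping.lookup ?q m) *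
          (\<Prod>i<k. ?S m i (\<alpha> i) * ffact (Var i) (\<alpha> i)))"
    by (simp add: Const_sum Const_hom Const_of_nat mffact_def sum_distrib_right prod.distrib mult.assoc
        del: of_nat_prod) (simp add: mult.assoc)
  also have "\<dots> = (\<Sum>m\<in>Poly_Mapping.keys ?q. Const (Poly_Mapping.lookup ?q m) *
          (\<Sum>\<alpha>\<in>box k \<nu>. \<Prod>i<k. ?S m i (\<alpha> i) * ffact (Var i) (\<alpha> i)))"
    unfolding sum_distrib_left by (rule sum.swap)
  also have "\<dots> = (\<Sum>m\<in>Poly_Mapping.keys ?q. Const (Poly_Mapping.lookup ?q m) *
          (\<Prod>i<k. \<Sum>a\<le>\<nu> i. ?S m i a * ffact (Var i) a))" (is "_ = ?rhs")
    unfolding box_def by (subst prod_sum_PiE) auto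
  finally have r: "(\<Sum>\<alpha>\<in>box k \<nu>. Const (\<phi> (1 / of_nat (mfact k \<alpha>)) * mDelta k \<alpha> p x v) * mffact k Var \<alpha>) = ?rhs" .
  have "?q - ?rhs = (\<Sum>m\<in>Poly_Mapping.keys ?q. Const (Poly_Mapping.lookup ?q m) *
      ((\<Prod>i<k. Var i ^ Poly_Mapping.lookup m i) - (\<Prod>i<k. \<Sum>a\<le>\<nu> i. ?S m i a * ffact (Var i) a)))"
    by (subst (1) q) (simp only: sum_subtractf right_diff_distrib)
  also have "\<dots> \<in> grid_ideal k \<nu>"
    by (intro grid.sum_mem grid.mult_mem grid.prod_diff_mem grid_power_Var closed) auto
  finally show ?thesis unfolding r .
qed

text \<open>
  The contribution of a monomial \<open>\<epsilon>\<^sup>m\<close> of the pullback to the sum is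
  \<open>\<nu>! \<Prod>\<^sub>i S(m\<^sub>i, \<nu>\<^sub>i) \<epsilon>\<^sup>m\<close>. If some \<open>m\<^sub>i < \<nu>\<^sub>i\<close>, a Stirling number is zero; if some \<open>m\<^sub>i > \<nu>\<^sub>i\<close>, the
  monomial lies in the ideal; and \<open>m = \<nu>\<close> gives \<open>\<nu>!\<close> times the coefficient, which is the
  derivative.
\<close>

lemma taylor_scaling_identity:
  fixes p :: "'r::comm_ring_1 mpoly"
  shows "mpow k Var \<nu> * Const (mDeriv k \<nu> p x v)
      - (\<Sum>\<beta>\<in>box k \<nu>. (-1) ^ wt k (\<lambda>i. \<nu> i - \<beta> i) * of_nat (\<Prod>i<k. \<nu> i choose \<beta> i) *
          eval_mpoly Const (affine_pullback k p x v) (\<lambda>i. of_nat (\<beta> i) * Var i))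
      \<in> taylor_ideal k \<nu>"
proof -
  let ?q = "affine_pullback k p x v"
  let ?c = "\<lambda>\<beta>. (-1) ^ wt k (\<lambda>i. \<nu> i - \<beta> i) * of_nat (\<Prod>i<k. \<nu> i choose \<beta> i) :: 'r mpoly"
  let ?S = "\<lambda>m. of_nat (mfact k \<nu>) * of_nat (\<Prod>i<k. Stirling (Poly_Mapping.lookup m i) (\<nu> i)) :: 'r mpoly"
  let ?L = "\<lambda>m. if m = box_monomial k \<nu> then Const (Poly_Mapping.lookup ?q m) * (of_nat (mfact k \<nu>) * mpow k Var \<nu>) else 0"
  let ?R = "\<lambda>m. Const (Poly_Mapping.lookup ?q m) * (?S m * mpow k Var (Poly_Mapping.lookup m))"
  have "(\<Sum>\<beta>\<in>box k \<nu>. ?c \<beta> * eval_mpoly Const ?q (\<lambda>i. of_nat (\<beta> i) * Var i))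
      = (\<Sum>\<beta>\<in>box k \<nu>. \<Sum>m\<in>Poly_Mapping.keys ?q. Const (Poly_Mapping.lookup ?q m) *
          (?c \<beta> * (\<Prod>i<k. (of_nat (\<beta> i) * Var i) ^ Poly_Mapping.lookup m i)))"
    unfolding eval_mpoly_ring[OF affine_pullback_closed] sum_distrib_left
    by (intro sum.cong) (simp_all add: mult_ac)
  also have "\<dots> = (\<Sum>m\<in>Poly_Mapping.keys ?q. Const (Poly_Mapping.lookup ?q m) *
      (\<Sum>\<beta>\<in>box k \<nu>. ?c \<beta> * (\<Prod>i<k. (of_nat (\<beta> i) * Var i) ^ Poly_Mapping.lookup m i)))"
    unfolding sum_distrib_left by (rule sum.swap)
  also have "\<dots> = (\<Sum>m\<in>Poly_Mapping.keys ?q. ?R m)"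
    by (simp only: sum_box_binomial_power mpow_def)
  finally have R: "(\<Sum>\<beta>\<in>box k \<nu>. ?c \<beta> * eval_mpoly Const ?q (\<lambda>i. of_nat (\<beta> i) * Var i))
      = (\<Sum>m\<in>Poly_Mapping.keys ?q. ?R m)" .
  have L: "mpow k Var \<nu> * Const (mDeriv k \<nu> p x v) = (\<Sum>m\<in>Poly_Mapping.keys ?q. ?L m)"
    by (auto simp: mDeriv_eq_fact_coeff Const_hom Const_of_nat in_keys_iff mult_ac)
  have "?L m - ?R m \<in> taylor_ideal k \<nu>" if m: "m \<in> Poly_Mapping.keys ?q" for m
  proof -
    have "Poly_Mapping.keys m \<subseteq> {..<k}"
      using affine_pullback_closed m unfolding mem_mpoly_ring by blast
    note eq = eq_box_monomial_iff[OF this, of \<nu>]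
    consider "\<forall>i<k. Poly_Mapping.lookup m i = \<nu> i" | i where "i < k" "Poly_Mapping.lookup m i < \<nu> i"
      | i where "i < k" "\<nu> i < Poly_Mapping.lookup m i"
      by (meson nat_neq_iff)
    then show ?thesis
    proof cases
      case 1
      then have "m = box_monomial k \<nu>" by (simp only: eq)
      moreover have "mpow k Var (Poly_Mapping.lookup m) = (mpow k Var \<nu> :: 'r mpoly)"
        using 1 by (simp add: mpow_def)
      moreover have "?S m = of_nat (mfact k \<nu>)"
        using 1 by simp
      ultimately have "?L m - ?R m = 0" by simp
      then show ?thesis by (simp only: taylor.zero_mem)
    next
      case 2
      then have "m \<noteq> box_monomial k \<nu>" by (auto simp: eq)
      moreover have "(\<Prod>i<k. Stirling (Poly_Mapping.lookup m i) (\<nu> i)) = 0"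
        using 2 by (intro prod_zero bexI[of _ i]) simp_all
      ultimately have "?L m - ?R m = 0"
        by (simp only: if_False of_nat_0 mult_zero_left mult_zero_right diff_0 minus_zero)
      then show ?thesis by (simp only: taylor.zero_mem)
    next
      case 3
      then have "m \<noteq> box_monomial k \<nu>" by (auto simp: eq)
      then have diff: "?L m - ?R m
          = (- Const (Poly_Mapping.lookup ?q m) * ?S m) * mpow k Var (Poly_Mapping.lookup m)"
        by (simp only: if_False mult.assoc minus_mult_left diff_0)
      have "(mpow k Var (Poly_Mapping.lookup m) :: 'r mpoly) \<in> taylor_ideal k \<nu>"
        unfolding mem_taylor_ideal_iff
      proof
        show "\<forall>m'\<in>Poly_Mapping.keys (mpow k Var (Poly_Mapping.lookup m) :: 'r mpoly).
            \<exists>i<k. \<nu> i < Poly_Mapping.lookup m' i"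
          using 3 by (intro ballI exI[of _ i]) (simp add: mpow_Var lookup_box_monomial)
      qed (rule mpow_closed)
      then show ?thesis
        unfolding diff by (intro taylor.mult_mem closed)
    qed
  qed
  then show ?thesis
    unfolding R L sum_subtractf[symmetric] by (rule taylor.sum_mem)
qed

theorem proposition24:
  fixes \<phi> :: "rat \<Rightarrow> 'r::comm_ring_1"
    and k d :: nat and \<nu> :: "nat \<Rightarrow> nat"
    and p :: "'r mpoly" and x :: "nat \<Rightarrow> 'r" and v :: "nat \<Rightarrow> nat \<Rightarrow> 'r"
  assumes "rat_embedding \<phi>"
    and "p \<in> carrier (mpoly_ring d)"
  shows
    "grid_class k \<nu> (eval_mpoly Const p (\<lambda>j. Const (x j) + (\<Sum>i<k. Var i * Const (v i j))))
       = grid_class k \<nu>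
           (\<Sum>\<alpha>\<in>box k \<nu>. Const (\<phi> (1 / of_nat (mfact k \<alpha>)) * mDelta k \<alpha> p x v) * mffact k Var \<alpha>)
     \<and> (\<forall>\<alpha>. mDelta k \<alpha> p x v =
           (\<Sum>\<beta>\<in>box k \<alpha>. (-1) ^ wt k (\<lambda>i. \<alpha> i - \<beta> i) * \<phi> (mcoef k \<alpha> \<beta>) *
              eval_mpoly id p (\<lambda>j. x j + (\<Sum>i<k. of_nat (\<beta> i) * v i j))))
     \<and> taylor_class k \<nu> (eval_mpoly Const p (\<lambda>j. Const (x j) + (\<Sum>i<k. Var i * Const (v i j))))
       = taylor_class k \<nu>
           (\<Sum>\<alpha>\<in>box k \<nu>. Const (\<phi> (1 / of_nat (mfact k \<alpha>)) * mDeriv k \<alpha> p x v) * mpow k Var \<alpha>)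
     \<and> taylor_class k \<nu> (mpow k Var \<nu> * Const (mDeriv k \<nu> p x v))
       = taylor_class k \<nu>
           (\<Sum>\<beta>\<in>box k \<nu>. (-1) ^ wt k (\<lambda>i. \<nu> i - \<beta> i) * Const (\<phi> (mcoef k \<nu> \<beta>)) *
              eval_mpoly Const p (\<lambda>j. Const (x j) + (\<Sum>i<k. of_nat (\<beta> i) * Var i * Const (v i j))))"
proof -
  let ?q = "affine_pullback k p x v"
  note \<phi> = assms(1)
  have \<phi>_mcoef: "\<phi> (mcoef k \<alpha> \<beta>) = of_nat (\<Prod>i<k. \<alpha> i choose \<beta> i)" for \<alpha> \<beta>
    unfolding mcoef_eq_binomial by (rule rat_embedding_of_nat[OF \<phi>])
  have deriv: "\<phi> (1 / of_nat (mfact k \<alpha>)) * mDeriv k \<alpha> p x v = Poly_Mapping.lookup ?q (box_monomial k \<alpha>)" for \<alpha>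
    unfolding mDeriv_eq_fact_coeff mult.assoc[symmetric] rat_embedding_inverse_mfact[OF \<phi>] by (rule mult_1)
  have scaled_closed: "eval_mpoly Const ?q (\<lambda>i. of_nat (\<beta> i) * Var i) \<in> carrier (mpoly_ring k)" for \<beta>
    unfolding Const_hom.eval_affine_pullback by (intro eval_closed closed) auto
  show ?thesis
  proof (intro conjI allI, fold affine_pullback_def)
    show "grid_class k \<nu> ?q = grid_class k \<nu>
        (\<Sum>\<alpha>\<in>box k \<nu>. Const (\<phi> (1 / of_nat (mfact k \<alpha>)) * mDelta k \<alpha> p x v) * mffact k Var \<alpha>)"
      unfolding grid_class_def
      by (intro grid.coset_eqI grid_expansion \<phi> affine_pullback_closed closed mffact_closed)
    show "mDelta k \<alpha> p x v =
           (\<Sum>\<beta>\<in>box k \<alpha>. (-1) ^ wt k (\<lambda>i. \<alpha> i - \<beta> i) * \<phi> (mcoef k \<alpha> \<beta>) *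
              eval_mpoly id p (\<lambda>j. x j + (\<Sum>i<k. of_nat (\<beta> i) * v i j)))" for \<alpha>
      unfolding \<phi>_mcoef by (rule mDelta_eq_binomial_sum)
    show "taylor_class k \<nu> ?q = taylor_class k \<nu>
        (\<Sum>\<alpha>\<in>box k \<nu>. Const (\<phi> (1 / of_nat (mfact k \<alpha>)) * mDeriv k \<alpha> p x v) * mpow k Var \<alpha>)"
      unfolding taylor_class_def deriv
      by (intro taylor.coset_eqI taylor_expansion affine_pullback_closed closed mpow_closed)
    show "taylor_class k \<nu> (mpow k Var \<nu> * Const (mDeriv k \<nu> p x v)) = taylor_class k \<nu>
        (\<Sum>\<beta>\<in>box k \<nu>. (-1) ^ wt k (\<lambda>i. \<nu> i - \<beta> i) * Const (\<phi> (mcoef k \<nu> \<beta>)) *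
           eval_mpoly Const p (\<lambda>j. Const (x j) + (\<Sum>i<k. of_nat (\<beta> i) * Var i * Const (v i j))))"
      unfolding taylor_class_def \<phi>_mcoef Const_of_nat Const_hom.eval_affine_pullback[symmetric]
      by (intro taylor.coset_eqI taylor_scaling_identity closed mpow_closed scaled_closed)
  qed
qed

end
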